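(* Let $k\ge 2$, let $F=F(a_1,\dots,a_k)$ be the free group with fixed free basis $\{a_1,\dots,a_k\}$, and let $\phi\in \mathrm{Aut}(F)$. Then there exists a closed interval $J\subseteq\mathbb R$ such that $I(\phi)=J\cap\mathbb Q$, where $$I(\phi)=\left\{\frac{\|\phi(w)\|}{\|w\|}: w\in F,\ w\ne 1\right\}.$$ Moreover, the endpoints of $J$ are positive rational numbers, and they are algorithmically computable in terms of $\phi$ (i.e. there is an algorithm that, given $\phi$, say by the words $\phi(a_1),\dots,\phi(a_k)$, outputs the two endpoints of $J$).
   Context: For $g\in F$, $\|g\|$ denotes the length, with respect to the fixed free basis $\{a_1,\dots,a_k\}$, of a cyclically reduced word conjugate to $g$ (so $\|g\|$ depends only on the conjugacy class of $g$). The set $I(\phi)$ is called the conjugacy distortion spectrum of $\phi$. A closed interval may be degenerate (a single point). *)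

theory Defs
  imports Complex_Main "HOL-Algebra.Bij" "HOL-Library.Nat_Bijection"
begin

text \<open>The letter \<open>(i, False)\<close> is the basis element with index \<open>i\<close> (counting from 0),
  and \<open>(i, True)\<close> is its inverse.\<close>

type_synonym letter = "nat \<times> bool"
type_synonym word = "letter list"

definition inv_letter :: "letter \<Rightarrow> letter" where
  "inv_letter x = (fst x, \<not> snd x)"

definition reduced :: "word \<Rightarrow> bool" where
  "reduced w \<longleftrightarrow> successively (\<lambda>x y. y \<noteq> inv_letter x) w"

fun cancel_cons :: "letter \<Rightarrow> word \<Rightarrow> word" where
  "cancel_cons x [] = [x]"
| "cancel_cons x (y # ys) = (if y = inv_letter x then ys else x # y # ys)"

definition free_reduce :: "word \<Rightarrow> word" where
  "free_reduce w = foldr cancel_cons w []"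

definition free_grp :: "nat \<Rightarrow> word monoid" where
  "free_grp k = \<lparr>carrier = {w. reduced w \<and> fst ` set w \<subseteq> {..<k}},
                 mult = (\<lambda>u v. free_reduce (u @ v)), one = []\<rparr>"

definition gen :: "nat \<Rightarrow> word" where
  "gen i = [(i, False)]"

lemma inv_letter_inv_letter [simp]: "inv_letter (inv_letter x) = x"
  by (simp add: inv_letter_def)

lemma inv_letter_neq [simp]: "inv_letter x \<noteq> x" "x \<noteq> inv_letter x"
  by (auto simp: inv_letter_def prod_eq_iff)

lemma fst_inv_letter [simp]: "fst (inv_letter x) = fst x"
  by (simp add: inv_letter_def)

lemma reduced_Nil [simp]: "reduced []"
  by (simp add: reduced_def)

lemma reduced_Cons:
  "reduced (x # w) \<longleftrightarrow> reduced w \<and> (w = [] \<or> hd w \<noteq> inv_letter x)"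
  by (cases w) (auto simp: reduced_def)

lemma reduced_cancel_cons: "reduced w \<Longrightarrow> reduced (cancel_cons x w)"
  by (cases w) (auto simp: reduced_Cons)

lemma set_cancel_cons: "set (cancel_cons x w) \<subseteq> insert x (set w)"
  by (cases w) auto

lemma cancel_cons_inv_letter:
  "reduced w \<Longrightarrow> cancel_cons (inv_letter x) (cancel_cons x w) = w"
  "reduced w \<Longrightarrow> cancel_cons x (cancel_cons (inv_letter x) w) = w"
proof -
  show *: "cancel_cons (inv_letter x) (cancel_cons x w) = w" if "reduced w" for x
  proof (cases w)
    case (Cons y ys)
    then show ?thesis
      using that by (cases ys) (auto simp: reduced_Cons)
  qed simp
  show "reduced w \<Longrightarrow> cancel_cons x (cancel_cons (inv_letter x) w) = w"
    using *[of "inv_letter x"] by simp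
qed

lemma reduced_foldr: "reduced w \<Longrightarrow> reduced (foldr cancel_cons u w)"
  by (induction u) (auto intro: reduced_cancel_cons)

lemma reduced_free_reduce: "reduced (free_reduce w)"
  by (simp add: free_reduce_def reduced_foldr)

lemma set_free_reduce: "set (free_reduce w) \<subseteq> set w"
  unfolding free_reduce_def
  by (induction w) (use set_cancel_cons in fastforce)+

lemma free_reduce_reduced: "reduced w \<Longrightarrow> free_reduce w = w"
  unfolding free_reduce_def
proof (induction w)
  case (Cons x w)
  then show ?case by (cases w) (auto simp: reduced_Cons)
qed simp

lemma foldr_cancel_cons_cancel_cons:
  "reduced w \<Longrightarrow> foldr cancel_cons (cancel_cons x u) w = cancel_cons x (foldr cancel_cons u w)"
  by (cases u) (auto simp: cancel_cons_inv_letter reduced_foldr)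

lemma foldr_free_reduce:
  "reduced w \<Longrightarrow> foldr cancel_cons (free_reduce u) w = foldr cancel_cons u w"
  unfolding free_reduce_def
  by (induction u) (auto simp: foldr_cancel_cons_cancel_cons)

lemma free_reduce_append_left: "free_reduce (free_reduce u @ v) = free_reduce (u @ v)"
  using foldr_free_reduce[of "free_reduce v" u] reduced_free_reduce
  by (simp add: free_reduce_def)

lemma free_reduce_append_right: "free_reduce (u @ free_reduce v) = free_reduce (u @ v)"
  using foldr_free_reduce[of "[]" v] by (simp add: free_reduce_def)

lemma free_reduce_inverse: "free_reduce (map inv_letter (rev w) @ w) = []"
proof (induction w rule: rev_induct)
  case (snoc x w)
  have "free_reduce (map inv_letter (rev (w @ [x])) @ w @ [x])
      = free_reduce ([inv_letter x] @ free_reduce (free_reduce (map inv_letter (rev w) @ w) @ [x]))"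
    by (simp only: free_reduce_append_left free_reduce_append_right) simp
  also have "\<dots> = []"
    unfolding snoc.IH by (simp add: free_reduce_def)
  finally show ?case .
qed (simp add: free_reduce_def)

lemma reduced_inverse:
  assumes "reduced w" shows "reduced (map inv_letter (rev w))"
proof -
  have "successively (\<lambda>x y. y \<noteq> inv_letter x) w \<Longrightarrow>
        successively (\<lambda>x y. inv_letter x \<noteq> y) w"
    by (erule successively_mono) auto
  moreover have "inv_letter x = inv_letter y \<longleftrightarrow> x = y" for x y
    by (metis inv_letter_inv_letter)
  ultimately show ?thesis
    using assms unfolding reduced_def
    by (auto simp: successively_map successively_rev)
qed

lemma group_free_grp: "group (free_grp k)"
proof (rule groupI)
  fix x y assume "x \<in> carrier (free_grp k)" "y \<in> carrier (free_grp k)"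
  then show "x \<otimes>\<^bsub>free_grp k\<^esub> y \<in> carrier (free_grp k)"
    using set_free_reduce[of "x @ y"]
    by (fastforce simp: free_grp_def reduced_free_reduce)
next
  fix x y z
  show "x \<otimes>\<^bsub>free_grp k\<^esub> y \<otimes>\<^bsub>free_grp k\<^esub> z = x \<otimes>\<^bsub>free_grp k\<^esub> (y \<otimes>\<^bsub>free_grp k\<^esub> z)"
    by (simp add: free_grp_def free_reduce_append_left free_reduce_append_right)
next
  fix x assume x: "x \<in> carrier (free_grp k)"
  have "map inv_letter (rev x) \<in> carrier (free_grp k)"
    using x by (auto simp: free_grp_def reduced_inverse)
  moreover have "map inv_letter (rev x) \<otimes>\<^bsub>free_grp k\<^esub> x = \<one>\<^bsub>free_grp k\<^esub>"
    by (simp add: free_grp_def free_reduce_inverse)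
  ultimately show "\<exists>y\<in>carrier (free_grp k). y \<otimes>\<^bsub>free_grp k\<^esub> x = \<one>\<^bsub>free_grp k\<^esub>"
    by blast
qed (auto simp: free_grp_def free_reduce_reduced)

definition cyclically_reduced :: "word \<Rightarrow> bool" where
  "cyclically_reduced w \<longleftrightarrow> reduced w \<and> (w \<noteq> [] \<longrightarrow> hd w \<noteq> inv_letter (last w))"

definition conj_in :: "nat \<Rightarrow> word \<Rightarrow> word \<Rightarrow> bool" where
  "conj_in k g g' \<longleftrightarrow> (\<exists>h\<in>carrier (free_grp k).
     g' = h \<otimes>\<^bsub>free_grp k\<^esub> g \<otimes>\<^bsub>free_grp k\<^esub> inv\<^bsub>free_grp k\<^esub> h)"

definition conj_length :: "nat \<Rightarrow> word \<Rightarrow> nat" where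
  "conj_length k g = (THE n. \<exists>w\<in>carrier (free_grp k).
     cyclically_reduced w \<and> conj_in k g w \<and> n = length w)"

definition distortion_spectrum :: "nat \<Rightarrow> (word \<Rightarrow> word) \<Rightarrow> real set" where
  "distortion_spectrum k \<phi> =
     {real (conj_length k (\<phi> w)) / real (conj_length k w) | w.
        w \<in> carrier (free_grp k) \<and> w \<noteq> \<one>\<^bsub>free_grp k\<^esub>}"

text \<open>Programs are Kleene's schemes for partial recursive functions on tuples of naturals.
  \<open>evaluates p xs y\<close> means that \<open>p\<close> halts on input \<open>xs\<close> with output \<open>y\<close>.\<close>

datatype program =
    Zero | Succ | Proj nat
  | Comp program "program list"
  | PrimRec program program
  | Mu program

inductive evaluates :: "program \<Rightarrow> nat list \<Rightarrow> nat \<Rightarrow> bool" where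
  "evaluates Zero xs 0"
| "evaluates Succ [x] (Suc x)"
| "i < length xs \<Longrightarrow> evaluates (Proj i) xs (xs ! i)"
| "list_all2 (\<lambda>q y. evaluates q xs y) qs ys \<Longrightarrow> evaluates p ys z \<Longrightarrow>
     evaluates (Comp p qs) xs z"
| "evaluates p xs y \<Longrightarrow> evaluates (PrimRec p q) (0 # xs) y"
| "evaluates (PrimRec p q) (n # xs) r \<Longrightarrow> evaluates q (n # r # xs) y \<Longrightarrow>
     evaluates (PrimRec p q) (Suc n # xs) y"
| "evaluates p (n # xs) 0 \<Longrightarrow> (\<forall>m<n. \<exists>y. evaluates p (m # xs) (Suc y)) \<Longrightarrow>
     evaluates (Mu p) xs n"

lemma evaluates_deterministic:
  "evaluates p xs y \<Longrightarrow> evaluates p xs y' \<Longrightarrow> y = y'"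
proof (induction p xs y arbitrary: y' rule: evaluates.induct)
  case (1 xs)
  then show ?case by cases auto
next
  case (2 x)
  then show ?case by cases auto
next
  case (3 i xs)
  from "3.prems" show ?case by cases auto
next
  case (4 xs qs ys p z)
  from "4.prems" obtain ys' where ys':
    "list_all2 (\<lambda>q y. evaluates q xs y) qs ys'" "evaluates p ys' y'"
    by cases auto
  have "ys = ys'"
    using "4.IH"(1) ys'(1) by (auto simp: list_all2_conv_all_nth intro!: nth_equalityI)
  then show ?case using "4.IH"(2) ys'(2) by blast
next
  case (5 p xs y q)
  from "5.prems" have "evaluates p xs y'" by cases auto
  then show ?case by (rule "5.IH")
next
  case (6 p q n xs r y)
  from "6.prems" obtain r' where r': "evaluates (PrimRec p q) (n # xs) r'"
    "evaluates q (n # r' # xs) y'"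
    by cases auto
  from "6.IH"(1)[OF r'(1)] r'(2) show ?case by (auto intro: "6.IH"(2))
next
  case (7 p n xs)
  from "7.prems" have y': "evaluates p (y' # xs) 0"
    "\<forall>m<y'. \<exists>y. evaluates p (m # xs) (Suc y)"
    by (cases; simp)+
  show ?case
  proof (rule linorder_cases[of n y'])
    assume "n < y'" then show ?thesis using y'(2) "7.IH"(1) by blast
  next
    assume "y' < n" then show ?thesis using y'(1) "7.IH"(2) by blast
  qed
qed

definition word_code :: "word \<Rightarrow> nat" where
  "word_code w = list_encode (map (\<lambda>(i, b). 2 * i + of_bool b) w)"

text \<open>The fraction need not be in lowest terms; denominator 0 yields 0.\<close>

definition frac_of_code :: "nat \<Rightarrow> rat" where
  "frac_of_code c = (case prod_decode c of (m, n) \<Rightarrow> of_nat m / of_nat n)"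

definition outputs_rat_pair :: "program \<Rightarrow> nat list \<Rightarrow> rat \<Rightarrow> rat \<Rightarrow> bool" where
  "outputs_rat_pair P xs a b \<longleftrightarrow>
     (\<exists>c d. evaluates P xs (prod_encode (c, d)) \<and> frac_of_code c = a \<and> frac_of_code d = b)"

end

theory Submission
  imports Defs
begin

text \<open>By bounded cancellation there are constants such that, for a reduced word \<open>x v y\<close> whose
  middle part \<open>v\<close> is long, \<open>\<bar>\<phi>(x v y)\<bar> + \<bar>\<phi>(v)\<bar> = \<bar>\<phi>(x v)\<bar> + \<bar>\<phi>(v y)\<bar>\<close>. Hence
  \<open>\<parallel>\<phi>(p)\<parallel> = \<bar>\<phi>(p v)\<bar> - \<bar>\<phi>(v)\<bar>\<close> is additive on the words \<open>p\<close> that are closed walks based at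
  \<open>v\<close> (\<open>p v\<close> is reduced and starts with \<open>v\<close>). By the pigeonhole principle every long cyclic word
  splits into two such walks, so the extremal ratios occur on words of bounded length, and they can be
  found by search once a bound for the images of the basis under \<open>\<phi>\<close> and \<open>\<phi>\<^sup>-\<^sup>1\<close> is known.
  Combining closed walks based at a common \<open>v\<close> gives all rational ratios in between.\<close>

section \<open>Reduced and cyclic length\<close>

text \<open>Neither length is additive under concatenation, and an extremum over infinitely many
  words need not be attained. Fixing a base window repairs both. On loops at one window numerator
  and denominator are additive, hence so is every integer combination of them. A bound on all ratios
  says that such a combination is nonnegative, a property which a product of two loops inherits from
  its factors; the length threshold merely counts the windows. A rational strictly between two
  ratios corresponds to a zero of such a combination. Rank at least two provides a letter that joins
  any two windows without cancellation.

  The constants depend on the inverse of \<phi>, which the input does not contain. The program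
  therefore searches for preimages of the basis together with two candidate extremal words. Checking
  a candidate involves only bounded quantifiers, every automorphism has a valid one, and all valid
  ones give the same endpoints, so it does not matter which is found.\<close>

abbreviation winv :: "word \<Rightarrow> word" where
  "winv w \<equiv> map inv_letter (rev w)"

definition rlen :: "word \<Rightarrow> nat" where
  "rlen w = length (free_reduce w)"

lemma inv_letter_eq_iff [simp]: "inv_letter x = inv_letter y \<longleftrightarrow> x = y"
  by (metis inv_letter_inv_letter)

lemma winv_winv [simp]: "winv (winv w) = w"
  by (simp add: rev_map o_def)

lemma reduced_append:
  "reduced (u @ v) \<longleftrightarrow> reduced u \<and> reduced v \<and> (u \<noteq> [] \<longrightarrow> v \<noteq> [] \<longrightarrow> hd v \<noteq> inv_letter (last u))"
  by (auto simp: reduced_def successively_append_iff)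

lemma reduced_overlap:
  "reduced (a @ m) \<Longrightarrow> reduced (m @ b) \<Longrightarrow> m \<noteq> [] \<Longrightarrow> reduced (a @ m @ b)"
  by (auto simp: reduced_append)

lemma reduced_connect:
  assumes "reduced u" "reduced v" "u \<noteq> []" "v \<noteq> []"
    and "x \<noteq> inv_letter (last u)" "hd v \<noteq> inv_letter x"
  shows "reduced (u @ x # v)"
  using assms by (simp add: reduced_append reduced_Cons)

lemma free_reduce_Nil [simp]: "free_reduce [] = []"
  by (simp add: free_reduce_def)

lemma free_reduce_idem [simp]: "free_reduce (free_reduce w) = free_reduce w"
  by (simp add: free_reduce_reduced reduced_free_reduce)

lemma free_reduce_append_cong:
  "free_reduce u = free_reduce u' \<Longrightarrow> free_reduce v = free_reduce v' \<Longrightarrow>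
    free_reduce (u @ v) = free_reduce (u' @ v')"
  by (metis free_reduce_append_left free_reduce_append_right)

lemma free_reduce_inverse_right: "free_reduce (w @ winv w) = []"
  using free_reduce_inverse[of "winv w"] by simp

lemma free_reduce_cancel:
  "free_reduce (u @ winv w @ w @ v) = free_reduce (u @ v)"
  "free_reduce (u @ w @ winv w @ v) = free_reduce (u @ v)"
  using free_reduce_append_cong[of u u "winv w @ w @ v" "v"]
    free_reduce_append_cong[of "winv w @ w" "[]" v v]
    free_reduce_append_cong[of u u "w @ winv w @ v" "v"]
    free_reduce_append_cong[of "w @ winv w" "[]" v v]
    free_reduce_inverse[of w] free_reduce_inverse_right[of w]
  by simp_all

text \<open>Inserting \<open>?r @ winv ?r\<close> behind \<open>winv w\<close> lets
  \<open>winv w\<close> cancel against \<open>?r\<close>, which leaves \<open>winv ?r\<close>, a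
  word that is already reduced.\<close>

lemma free_reduce_winv: "free_reduce (winv w) = winv (free_reduce w)"
proof -
  let ?r = "free_reduce w"
  have "free_reduce (winv w) = free_reduce (winv w @ ?r @ winv ?r)"
    using free_reduce_cancel(2)[of "winv w" ?r "[]"] by simp
  also have "\<dots> = free_reduce ((winv w @ w) @ winv ?r)"
    unfolding append_assoc
    by (intro free_reduce_append_cong) (simp_all del: append_assoc)
  also have "\<dots> = free_reduce (winv ?r)"
    using free_reduce_cancel(1)[of "[]" w "winv ?r"] by simp
  also have "\<dots> = winv ?r"
    by (intro free_reduce_reduced reduced_inverse reduced_free_reduce)
  finally show ?thesis .
qed

lemma rlen_cong: "free_reduce u = free_reduce v \<Longrightarrow> rlen u = rlen v"
  by (simp add: rlen_def)

lemma rlen_Nil [simp]: "rlen [] = 0"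
  by (simp add: rlen_def)

lemma rlen_reduced: "reduced w \<Longrightarrow> rlen w = length w"
  by (simp add: rlen_def free_reduce_reduced)

lemma length_cancel_cons: "length (cancel_cons x w) \<le> Suc (length w)"
  by (cases w) auto

lemma length_foldr_cancel_cons: "length (foldr cancel_cons u w) \<le> length u + length w"
proof (induction u)
  case (Cons x u)
  then show ?case
    using length_cancel_cons[of x "foldr cancel_cons u w"] by simp
qed simp

lemma rlen_le_length: "rlen w \<le> length w"
  using length_foldr_cancel_cons[of w "[]"] by (simp add: rlen_def free_reduce_def)

lemma rlen_free_reduce [simp]: "rlen (free_reduce w) = rlen w"
  by (simp add: rlen_def)

lemma rlen_append: "rlen (u @ v) \<le> rlen u + rlen v"
  using rlen_le_length[of "free_reduce u @ free_reduce v"]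
  by (simp add: rlen_def free_reduce_append_left free_reduce_append_right)

lemma rlen_winv [simp]: "rlen (winv w) = rlen w"
  by (simp add: rlen_def free_reduce_winv)

lemma rlen_right_le: "rlen v \<le> rlen u + rlen (u @ v)"
  using rlen_append[of "winv u" "u @ v"] free_reduce_cancel(1)[of "[]" u v]
  by (simp add: rlen_def free_reduce_winv)

lemma rlen_left_le: "rlen u \<le> rlen (u @ v) + rlen v"
  using rlen_append[of "u @ v" "winv v"] free_reduce_cancel(2)[of u v "[]"]
  by (simp add: rlen_def free_reduce_winv)

text \<open>Induction from the right end of \<open>x\<close>: its last letter either meets
  \<open>y\<close> without cancelling or removes the first letter of \<open>y\<close>. The word
  \<open>t\<close> collects what cancels, so \<open>a @ b\<close> is the reduced product.\<close>

lemma cancellation: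
  assumes "reduced x" "reduced y"
  obtains a t b where "x = a @ t" "y = winv t @ b" "reduced (a @ b)"
proof -
  have "\<exists>a t b. x = a @ t \<and> y = winv t @ b \<and> reduced (a @ b)"
    using assms
  proof (induction x arbitrary: y rule: rev_induct)
    case Nil
    then show ?case by (auto intro: exI[of _ "[]"])
  next
    case (snoc l x)
    show ?case
    proof (cases "reduced ((x @ [l]) @ y)")
      case True
      then show ?thesis by (intro exI[of _ "x @ [l]"] exI[of _ "[]"] exI[of _ y]) simp
    next
      case False
      then obtain y' where y: "y = inv_letter l # y'"
        using snoc.prems by (cases y) (auto simp: reduced_append reduced_Cons)
      have "reduced x" "reduced y'"
        using snoc.prems y by (auto simp: reduced_append reduced_Cons)
      from snoc.IH[OF this] obtain a t b where "x = a @ t" "y' = winv t @ b" "reduced (a @ b)"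
        by blast
      then show ?thesis using y
        by (intro exI[of _ a] exI[of _ "t @ [l]"] exI[of _ b]) simp
    qed
  qed
  then show thesis using that by blast
qed

lemma free_reduce_cancelled:
  "reduced (a @ b) \<Longrightarrow> free_reduce ((a @ t) @ (winv t @ b)) = a @ b"
  using free_reduce_cancel(2)[of a t b] by (simp add: free_reduce_reduced)

section \<open>Powers of words and cyclic reduction\<close>

definition wpow :: "word \<Rightarrow> nat \<Rightarrow> word" where
  "wpow w n = concat (replicate n w)"

lemma wpow_0 [simp]: "wpow w 0 = []"
  and wpow_Suc [simp]: "wpow w (Suc n) = w @ wpow w n"
  by (simp_all add: wpow_def)

lemma wpow_add: "wpow w (m + n) = wpow w m @ wpow w n"
  by (simp add: wpow_def replicate_add)

lemma wpow_Suc_right: "wpow w (Suc n) = wpow w n @ w"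
  using wpow_add[of w n 1] by simp

lemma length_wpow [simp]: "length (wpow w n) = n * length w"
  by (induction n) auto

lemma wpow_eq_Nil [simp]: "wpow w n = [] \<longleftrightarrow> n = 0 \<or> w = []"
  by (simp flip: length_0_conv)

lemma length_wpow_ge: "w \<noteq> [] \<Longrightarrow> n \<le> length (wpow w n)"
  by (cases w) auto

lemma hd_wpow: "w \<noteq> [] \<Longrightarrow> 0 < n \<Longrightarrow> hd (wpow w n) = hd w"
  by (cases n) auto

lemma set_wpow: "set (wpow w n) \<subseteq> set w"
  by (induction n) auto

lemma free_reduce_wpow: "free_reduce u = free_reduce v \<Longrightarrow> free_reduce (wpow u n) = free_reduce (wpow v n)"
  by (induction n) (auto intro: free_reduce_append_cong)

lemma free_reduce_wpow_conj:
  "free_reduce (wpow (h @ u @ winv h) n) = free_reduce (h @ wpow u n @ winv h)"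
proof (induction n)
  case 0
  then show ?case by (simp add: free_reduce_inverse_right)
next
  case (Suc n)
  have "free_reduce (wpow (h @ u @ winv h) (Suc n))
      = free_reduce ((h @ u @ winv h) @ (h @ wpow u n @ winv h))"
    unfolding wpow_Suc by (rule free_reduce_append_cong) (use Suc in simp_all)
  also have "\<dots> = free_reduce (h @ wpow u (Suc n) @ winv h)"
    using free_reduce_cancel(1)[of "h @ u" h "wpow u n @ winv h"] by simp
  finally show ?case .
qed

lemma reduced_wpow:
  assumes "cyclically_reduced u" shows "reduced (wpow u n)"
proof (induction n)
  case (Suc n)
  then show ?case
    using assms by (cases n) (auto simp: cyclically_reduced_def reduced_append)
qed simp

lemma rlen_wpow_cyclic: "cyclically_reduced u \<Longrightarrow> rlen (wpow u n) = n * length u"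
  by (simp add: rlen_reduced reduced_wpow)

text \<open>Matching end letters are moved into \<open>h\<close> until none are left. A word of one
  letter has no such pair, because no letter is its own inverse, so each step shortens the word by
  two.\<close>

lemma cyclic_decomposition:
  assumes "reduced g"
  obtains h u where "g = h @ u @ winv h" "cyclically_reduced u"
proof -
  have "\<exists>h u. g = h @ u @ winv h \<and> cyclically_reduced u"
    using assms
  proof (induction g rule: length_induct)
    case (1 g)
    show ?case
    proof (cases "cyclically_reduced g")
      case True
      then show ?thesis by (intro exI[of _ "[]"] exI[of _ g]) simp
    next
      case False
      with 1 have ne: "g \<noteq> []" and eq: "hd g = inv_letter (last g)"
        by (auto simp: cyclically_reduced_def)
      then obtain l g1 where g1: "g = l # g1" by (cases g) auto
      with eq have "g1 \<noteq> []" by auto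
      then obtain g2 l' where "g1 = g2 @ [l']" by (metis rev_exhaust)
      with g1 eq have g: "g = [l] @ g2 @ [inv_letter l]" by auto
      then have "reduced g2" using 1 by (auto simp: reduced_append reduced_Cons)
      moreover have "length g2 < length g" by (simp add: g)
      ultimately obtain h u where "g2 = h @ u @ winv h" "cyclically_reduced u"
        using 1(1) by blast
      with g show ?thesis by (intro exI[of _ "l # h"] exI[of _ u]) simp
    qed
  qed
  then show thesis using that by blast
qed

text \<open>If \<open>w\<close> reduces to \<open>h u h\<^sup>-\<^sup>1\<close> with \<open>u\<close> cyclically reduced, then \<open>w\<^sup>n\<close> has reduced length
  \<open>2\<bar>h\<bar> + n\<bar>u\<bar>\<close>, so the following difference is \<open>\<bar>u\<bar>\<close>. It is also determined by the growth
  of the powers of \<open>w\<close>.\<close>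

definition cyc_len :: "word \<Rightarrow> nat" where
  "cyc_len w = rlen (w @ w) - rlen w"

lemma cyc_len_cong: "free_reduce u = free_reduce v \<Longrightarrow> cyc_len u = cyc_len v"
  unfolding cyc_len_def by (metis rlen_cong free_reduce_append_cong)

lemma cyc_len_free_reduce [simp]: "cyc_len (free_reduce w) = cyc_len w"
  by (rule cyc_len_cong) simp

lemma rlen_conj_bounds:
  "rlen u \<le> rlen (h @ u @ winv h) + 2 * rlen h" "rlen (h @ u @ winv h) \<le> rlen u + 2 * rlen h"
  using rlen_append[of h "u @ winv h"] rlen_append[of u "winv h"] rlen_winv[of h]
    rlen_right_le[of "u @ winv h" h] rlen_left_le[of u "winv h"]
  by linarith+

lemma cyc_len_conj_cyclic:
  assumes "cyclically_reduced u" "reduced (h @ u @ winv h)"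
  shows "cyc_len (h @ u @ winv h) = length u"
proof (cases "u = []")
  case True
  then have "rlen ((h @ u @ winv h) @ (h @ u @ winv h)) = rlen (h @ u @ winv h)"
    using free_reduce_cancel(1)[of h h "winv h"] by (intro rlen_cong) simp
  with True show ?thesis by (simp add: cyc_len_def)
next
  case False
  have "reduced ((h @ u) @ (u @ winv h))"
    using assms False by (auto simp: reduced_append cyclically_reduced_def)
  then have "rlen ((h @ u) @ (u @ winv h)) = 2 * length u + 2 * length h"
    by (subst rlen_reduced) auto
  moreover have "rlen ((h @ u @ winv h) @ (h @ u @ winv h)) = rlen ((h @ u) @ (u @ winv h))"
    using free_reduce_cancel(1)[of "h @ u" h "u @ winv h"] by (intro rlen_cong) simp
  moreover have "rlen (h @ u @ winv h) = length u + 2 * length h"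
    using assms(2) by (subst rlen_reduced) auto
  ultimately show ?thesis by (simp add: cyc_len_def)
qed

lemma free_reduce_cyclic:
  obtains h u where "free_reduce w = h @ u @ winv h" "cyclically_reduced u" "length u = cyc_len w"
proof -
  obtain h u where 1: "free_reduce w = h @ u @ winv h" "cyclically_reduced u"
    using cyclic_decomposition[OF reduced_free_reduce] by metis
  moreover have "cyc_len w = length u"
    using cyc_len_conj_cyclic[OF 1(2), of h] reduced_free_reduce[of w]
    unfolding 1(1)[symmetric] by simp
  ultimately show thesis using that by simp
qed

lemma rlen_wpow_bound:
  obtains D where "\<And>n. \<bar>int (rlen (wpow w n)) - int n * int (cyc_len w)\<bar> \<le> D"
proof -
  obtain h u where *: "free_reduce w = h @ u @ winv h" "cyclically_reduced u" "length u = cyc_len w"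
    by (rule free_reduce_cyclic)
  have "\<bar>int (rlen (wpow w n)) - int n * int (cyc_len w)\<bar> \<le> 2 * int (rlen h)" for n
  proof -
    have "free_reduce (wpow w n) = free_reduce (wpow (h @ u @ winv h) n)"
      by (rule free_reduce_wpow) (metis *(1) free_reduce_idem)
    then have "rlen (wpow w n) = rlen (h @ wpow u n @ winv h)"
      by (intro rlen_cong) (simp only: free_reduce_wpow_conj)
    moreover have "rlen (wpow u n) = n * cyc_len w"
      using * by (simp add: rlen_wpow_cyclic)
    ultimately show ?thesis
      using rlen_conj_bounds[where u = "wpow u n" and h = h] by (simp flip: of_nat_mult)
  qed
  then show thesis by (rule that)
qed

lemma linear_growth_unique:
  fixes l l' :: int and r :: "nat \<Rightarrow> int"
  assumes "\<And>n. \<bar>r n - int n * l\<bar> \<le> D" "\<And>n. \<bar>r n - int n * l'\<bar> \<le> D'"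
  shows "l = l'"
proof (rule ccontr)
  assume "l \<noteq> l'"
  define n where "n = nat (D + D' + 1)"
  have "0 \<le> D" "0 \<le> D'" using assms[of 0] by linarith+
  then have n: "int n = D + D' + 1" by (simp add: n_def)
  have "\<bar>int n * (l - l')\<bar> \<le> D + D'"
    using assms[of n] by (simp add: algebra_simps)
  moreover have "int n * 1 \<le> int n * \<bar>l - l'\<bar>"
    using \<open>l \<noteq> l'\<close> by (intro mult_left_mono) auto
  ultimately show False using n by (simp add: abs_mult)
qed

text \<open>Cyclic length is the unique linear growth rate of the reduced lengths of powers. It can
  thus be identified from estimates with bounded error, without knowledge of the cyclic
  core.\<close>

lemma cyc_len_eqI:
  assumes "\<And>n. \<bar>int (rlen (wpow w n)) - int n * l\<bar> \<le> D"
  shows "int (cyc_len w) = l"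
proof -
  obtain D' where "\<And>n. \<bar>int (rlen (wpow w n)) - int n * int (cyc_len w)\<bar> \<le> D'"
    by (rule rlen_wpow_bound[of w]) blast
  then show ?thesis using assms by (rule linear_growth_unique)
qed

text \<open>Conjugation by \<open>h\<close> changes the reduced length of every power by at most
  \<open>2 * rlen h\<close>, which does not affect the growth rate.\<close>

lemma cyc_len_conj: "cyc_len (h @ w @ winv h) = cyc_len w"
proof -
  obtain D where D: "\<And>n. \<bar>int (rlen (wpow w n)) - int n * int (cyc_len w)\<bar> \<le> D"
    by (rule rlen_wpow_bound[of w]) blast
  have "int (cyc_len (h @ w @ winv h)) = int (cyc_len w)"
  proof (rule cyc_len_eqI)
    fix n
    have "rlen (wpow (h @ w @ winv h) n) = rlen (h @ wpow w n @ winv h)"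
      by (intro rlen_cong free_reduce_wpow_conj)
    then show "\<bar>int (rlen (wpow (h @ w @ winv h) n)) - int n * int (cyc_len w)\<bar> \<le> D + 2 * int (rlen h)"
      using rlen_conj_bounds[where u = "wpow w n" and h = h] D[of n] by linarith
  qed
  then show ?thesis by simp
qed

lemma cyc_len_rotate: "cyc_len (u @ v) = cyc_len (v @ u)"
proof -
  have "cyc_len (winv u @ (u @ v) @ winv (winv u)) = cyc_len (v @ u)"
    by (rule cyc_len_cong) (use free_reduce_cancel(1)[of "[]" u "v @ u"] in simp)
  then show ?thesis using cyc_len_conj[of "winv u" "u @ v"] by simp
qed

lemma wpow_wpow: "wpow (wpow w n) i = wpow w (i * n)"
  by (induction i) (simp_all add: wpow_add)

lemma cyc_len_wpow: "cyc_len (wpow w n) = n * cyc_len w"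
proof -
  obtain D where D: "\<And>i. \<bar>int (rlen (wpow w i)) - int i * int (cyc_len w)\<bar> \<le> D"
    by (rule rlen_wpow_bound[of w]) blast
  have "int (cyc_len (wpow w n)) = int n * int (cyc_len w)"
  proof (rule cyc_len_eqI)
    fix i
    show "\<bar>int (rlen (wpow (wpow w n) i)) - int i * (int n * int (cyc_len w))\<bar> \<le> D"
      using D[of "i * n"] by (simp add: wpow_wpow mult.assoc)
  qed
  then show ?thesis by (simp flip: of_nat_mult)
qed

lemma cyc_len_cyclic: "cyclically_reduced w \<Longrightarrow> cyc_len w = length w"
  using cyc_len_conj_cyclic[of w "[]"] by (simp add: cyclically_reduced_def)

lemma cyc_len_eq_0_iff: "cyc_len w = 0 \<longleftrightarrow> free_reduce w = []"
proof
  assume 0: "cyc_len w = 0"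
  obtain h u where "free_reduce w = h @ u @ winv h" "cyclically_reduced u" "length u = cyc_len w"
    by (rule free_reduce_cyclic)
  then have "free_reduce w = h @ winv h" using 0 by simp
  then show "free_reduce w = []"
    using free_reduce_inverse_right[of h] by (metis free_reduce_idem)
next
  assume "free_reduce w = []"
  then have "cyc_len w = cyc_len []" by (intro cyc_len_cong) simp
  then show "cyc_len w = 0" by (simp add: cyc_len_def)
qed

section \<open>Bounded cancellation\<close>

definition word_over :: "nat \<Rightarrow> word \<Rightarrow> bool" where
  "word_over k w \<longleftrightarrow> fst ` set w \<subseteq> {..<k}"

lemma word_over_Nil [simp]: "word_over k []"
  and word_over_Cons [simp]: "word_over k (x # w) \<longleftrightarrow> fst x < k \<and> word_over k w"
  and word_over_append [simp]: "word_over k (u @ v) \<longleftrightarrow> word_over k u \<and> word_over k v"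
  by (auto simp: word_over_def)

lemma word_over_iff_set: "word_over k w \<longleftrightarrow> set w \<subseteq> {..<k} \<times> UNIV"
  by (auto simp: word_over_def mem_Times_iff image_subset_iff subset_iff)

lemma word_over_winv [simp]: "word_over k (winv w) \<longleftrightarrow> word_over k w"
  by (simp add: word_over_def image_image)

lemma word_over_subset: "set u \<subseteq> set v \<Longrightarrow> word_over k v \<Longrightarrow> word_over k u"
  by (auto simp: word_over_def)

lemma word_over_free_reduce: "word_over k w \<Longrightarrow> word_over k (free_reduce w)"
  by (rule word_over_subset[OF set_free_reduce])

lemma word_over_wpow: "word_over k w \<Longrightarrow> word_over k (wpow w n)"
  by (rule word_over_subset[OF set_wpow])

text \<open>Two prefixes whose images lie within \<open>m\<close> of a common point have images at
  distance at most \<open>2 * m\<close>, hence are themselves at distance at most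
  \<open>2 * m ^ 2\<close>. Mapping back gives \<open>2 * m ^ 3\<close>, and \<open>m\<close> is the
  remaining distance to the point.\<close>

definition cancel_const :: "nat \<Rightarrow> nat" where
  "cancel_const m = m + 2 * m ^ 3"

text \<open>A reduced word this long has an image of reduced length at least
  \<open>2 * cancel_const m + 1\<close>, so that at least one letter survives cancellation from both
  sides.\<close>

definition window_len :: "nat \<Rightarrow> nat" where
  "window_len m = m * (2 * cancel_const m + 1)"

text \<open>Here \<open>f\<close> acts on unreduced words, so \<open>f_append\<close> is an equation
  between words, and reduction enters only when lengths are measured. The bound
  \<open>f_lower\<close> will come from the inverse automorphism; a single \<open>m\<close> serves
  both directions.\<close>

locale bilipschitz =
  fixes k m :: nat and f :: "word \<Rightarrow> word"
  assumes f_append: "f (x @ y) = f x @ f y"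
    and f_reduce: "free_reduce (f (free_reduce w)) = free_reduce (f w)"
    and f_letter: "fst l < k \<Longrightarrow> rlen (f [l]) \<le> m"
    and f_lower: "word_over k w \<Longrightarrow> rlen w \<le> m * rlen (f w)"
    and m_pos: "0 < m"
begin

lemma f_Nil [simp]: "f [] = []"
  using f_append[of "[]" "[]"] by simp

lemma f_cong: "free_reduce u = free_reduce v \<Longrightarrow> free_reduce (f u) = free_reduce (f v)"
  by (metis f_reduce)

lemma f_wpow: "f (wpow w n) = wpow (f w) n"
  by (induction n) (auto simp: f_append)

lemma f_winv: "free_reduce (f (winv w)) = winv (free_reduce (f w))"
proof -
  have "free_reduce (f (winv w)) = free_reduce (f (winv w) @ f w @ winv (f w))"
    using free_reduce_cancel(2)[of "f (winv w)" "f w" "[]"] by simp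
  also have "\<dots> = free_reduce (f (winv w @ w) @ winv (f w))"
    by (simp add: f_append)
  also have "\<dots> = free_reduce ([] @ winv (f w))"
    using f_cong[of "winv w @ w" "[]"]
    by (intro free_reduce_append_cong) (simp_all add: free_reduce_inverse)
  finally show ?thesis by (simp add: free_reduce_winv)
qed

lemma f_upper: "word_over k w \<Longrightarrow> rlen (f w) \<le> m * length w"
proof (induction w)
  case (Cons x w)
  have "rlen (f (x # w)) \<le> rlen (f [x]) + rlen (f w)"
    using f_append[of "[x]" w] rlen_append[of "f [x]" "f w"] by simp
  then show ?case using Cons f_letter[of x] by simp
qed simp

text \<open>The images of the prefixes of \<open>x\<close> form a path in a tree with jumps of
  length at most \<open>m\<close>, so the path comes within \<open>m\<close> of each vertex
  \<open>A\<close> on the geodesic to its end point.\<close>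

lemma image_path_near_geodesic:
  assumes "word_over k x" "free_reduce (f x) = A @ B"
  shows "\<exists>x' x''. x = x' @ x'' \<and> rlen (winv A @ f x') \<le> m"
  using assms
proof (induction x arbitrary: A B rule: rev_induct)
  case Nil
  then show ?case by simp
next
  case (snoc l x)
  obtain a t b where 1: "free_reduce (f x) = a @ t" "free_reduce (f [l]) = winv t @ b" "reduced (a @ b)"
    by (rule cancellation[OF reduced_free_reduce reduced_free_reduce])
  have "free_reduce (f (x @ [l])) = free_reduce (free_reduce (f x) @ free_reduce (f [l]))"
    unfolding f_append by (rule free_reduce_append_cong) simp_all
  also have "\<dots> = a @ b"
    unfolding 1 using 1(3) by (rule free_reduce_cancelled)
  finally have ab: "free_reduce (f (x @ [l])) = a @ b" .
  with snoc.prems(2) consider (left) c where "a = A @ c" | (right) c where "A = a @ c" "b = c @ B"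
    by (auto simp: append_eq_append_conv2)
  then show ?case
  proof cases
    case left
    with 1 snoc.prems obtain x' x'' where "x = x' @ x''" "rlen (winv A @ f x') \<le> m"
      using snoc.IH[of A "c @ t"] by auto
    then show ?thesis by (intro exI[of _ x'] exI[of _ "x'' @ [l]"]) simp
  next
    \<comment> \<open>Now \<open>A\<close> reaches beyond the part \<open>a\<close> that survives
      from the image of \<open>x\<close>, so the remainder \<open>B\<close> is a suffix of the image
      of the last letter.\<close>
    case right
    have "free_reduce (winv A @ f (x @ [l])) = free_reduce (winv A @ (A @ B))"
      by (rule free_reduce_append_cong) (simp_all flip: snoc.prems(2))
    also have "\<dots> = free_reduce B"
      using free_reduce_cancel(1)[of "[]" A B] by simp
    finally have "rlen (winv A @ f (x @ [l])) = rlen B" by (rule rlen_cong)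
    also have "\<dots> \<le> length B" by (rule rlen_le_length)
    also have "\<dots> \<le> length (free_reduce (f [l]))" using 1 right by simp
    also have "\<dots> \<le> m" using f_letter[of l] snoc.prems by (simp add: rlen_def)
    finally show ?thesis by (intro exI[of _ "x @ [l]"] exI[of _ "[]"]) simp
  qed
qed

text \<open>The point \<open>a\<close> lies on the geodesics from \<open>1\<close> to \<open>f x\<close> and from \<open>f x\<close> to \<open>f (x y)\<close>, so it is
  close to \<open>f x'\<close> and to \<open>f (x y')\<close> for suitable prefixes; their distance in the source is
  \<open>\<bar>x'' y'\<bar>\<close>, where \<open>x = x' x''\<close>.\<close>

lemma bounded_cancellation:
  assumes "reduced (x @ y)" and over: "word_over k x" "word_over k y"
    and x: "free_reduce (f x) = a @ t" and y: "free_reduce (f y) = winv t @ b"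
  shows "length t \<le> cancel_const m"
proof -
  obtain x' x'' where x': "x = x' @ x''" "rlen (winv a @ f x') \<le> m"
    using image_path_near_geodesic[OF over(1) x] by blast
  obtain y' y'' where y': "y = y' @ y''" "rlen (t @ f y') \<le> m"
    using image_path_near_geodesic[OF over(2) y] by auto
  have t: "free_reduce ((winv a @ f x') @ f x'') = free_reduce t"
  proof -
    have "free_reduce ((winv a @ f x') @ f x'') = free_reduce (winv a @ (a @ t))"
      unfolding append_assoc
      by (rule free_reduce_append_cong) (simp_all flip: x f_append x'(1))
    then show ?thesis using free_reduce_cancel(1)[of "[]" a t] by simp
  qed
  have "free_reduce ((winv a @ f x') @ f (x'' @ y')) = free_reduce (t @ f y')"
    using free_reduce_append_cong[OF t, of "f y'" "f y'"] by (simp add: f_append)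
  then have "rlen ((winv a @ f x') @ f (x'' @ y')) \<le> m"
    using y'(2) rlen_cong by metis
  then have "rlen (f (x'' @ y')) \<le> 2 * m"
    using rlen_right_le[of "f (x'' @ y')" "winv a @ f x'"] x'(2) by linarith
  \<comment> \<open>The hypothesis that \<open>x @ y\<close> is reduced enters here: the length of
    \<open>x'' @ y'\<close> is its reduced length, which \<open>f_lower\<close> controls.\<close>
  moreover have "reduced (x'' @ y')" "word_over k (x'' @ y')"
    using assms(1) over x'(1) y'(1) by (auto simp: reduced_append)
  ultimately have "length (x'' @ y') \<le> m * (2 * m)"
    using f_lower[of "x'' @ y'"] by (simp add: rlen_reduced) (meson le_trans mult_le_mono2)
  then have "rlen (f x'') \<le> m * (m * (2 * m))"
    using f_upper[of x''] over x'(1) by simp (meson le_trans mult_le_mono2 add_leD1)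
  then have "rlen t \<le> m + m * (m * (2 * m))"
    using rlen_append[of "winv a @ f x'" "f x''"] x'(2) rlen_cong[OF t] by linarith
  moreover have "reduced t"
    using reduced_free_reduce[of "f x"] by (simp add: x reduced_append)
  ultimately show ?thesis
    by (simp add: rlen_reduced cancel_const_def power3_eq_cube mult.assoc mult.left_commute)
qed

text \<open>A nonempty middle \<open>M\<close> of the image of \<open>v\<close> survives
  cancellation at both ends and keeps the two ends apart. The four reduced images are
  \<open>winv t @ M @ s\<close>, \<open>X @ M @ s\<close>, \<open>winv t @ M @ Y\<close> and
  \<open>X @ M @ Y\<close>, and the lengths can be compared directly.\<close>

lemma image_length_additive:
  assumes red: "reduced (x @ v)" "reduced (v @ y)"
    and over: "word_over k x" "word_over k v" "word_over k y"
    and long: "window_len m \<le> length v"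
  shows "rlen (f (x @ v @ y)) + rlen (f v) = rlen (f (x @ v)) + rlen (f (v @ y))"
proof -
  let ?V = "free_reduce (f v)"
  obtain X t V1 where X: "free_reduce (f x) = X @ t" "?V = winv t @ V1" "reduced (X @ V1)"
    by (rule cancellation[OF reduced_free_reduce reduced_free_reduce])
  obtain V2 s Y where Y: "?V = V2 @ s" "free_reduce (f y) = winv s @ Y" "reduced (V2 @ Y)"
    by (rule cancellation[OF reduced_free_reduce reduced_free_reduce])
  have "length t \<le> cancel_const m" "length s \<le> cancel_const m"
    using bounded_cancellation[OF red(1) over(1,2) X(1,2)]
      bounded_cancellation[OF red(2) over(2,3) Y(1,2)] by auto
  moreover have "reduced v" using red by (simp add: reduced_append)
  then have "m * (2 * cancel_const m + 1) \<le> m * length ?V"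
    using f_lower[OF over(2)] long by (simp add: window_len_def rlen_def free_reduce_reduced)
  then have "2 * cancel_const m + 1 \<le> length ?V"
    using m_pos by (meson mult_le_cancel1)
  ultimately have lt: "length t + length s < length ?V" by linarith
  obtain M where M: "V1 = M @ s" "V2 = winv t @ M"
  proof -
    from X(2) Y(1) have "winv t @ V1 = V2 @ s" by simp
    then consider us where "winv t = V2 @ us" "us @ V1 = s" | us where "winv t @ us = V2" "V1 = us @ s"
      by (auto simp: append_eq_append_conv2)
    then show thesis
    proof cases
      \<comment> \<open>Here \<open>winv t\<close> covers all of \<open>V2\<close>, so the two
        cancelled ends would exhaust the image of \<open>v\<close>, contrary to
        \<open>lt\<close>.\<close>
      case 1
      then have "length V2 \<le> length t" by (metis length_append length_map length_rev le_add1)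
      then show thesis using lt Y(1) by simp
    qed (use that in auto)
  qed
  have "M \<noteq> []" using lt X(2) M by auto
  have 1: "free_reduce (f (x @ v)) = X @ M @ s"
  proof -
    have "free_reduce (f (x @ v)) = free_reduce ((X @ t) @ (winv t @ V1))"
      unfolding f_append by (rule free_reduce_append_cong) (simp_all flip: X(1,2))
    also have "\<dots> = X @ V1" by (rule free_reduce_cancelled[OF X(3)])
    finally show ?thesis using M by simp
  qed
  have 2: "free_reduce (f (v @ y)) = winv t @ M @ Y"
  proof -
    have "free_reduce (f (v @ y)) = free_reduce ((V2 @ s) @ (winv s @ Y))"
      unfolding f_append by (rule free_reduce_append_cong) (simp_all flip: Y(1,2))
    also have "\<dots> = V2 @ Y" by (rule free_reduce_cancelled[OF Y(3)])
    finally show ?thesis using M by simp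
  qed
  have "reduced (X @ M)" "reduced (M @ Y)"
    using X(3) Y(3) M by (auto simp: reduced_append)
  then have red': "reduced (X @ M @ Y)" using \<open>M \<noteq> []\<close> by (intro reduced_overlap)
  have "free_reduce (f (x @ v @ y)) = free_reduce (f (x @ v) @ f y)"
    by (simp add: f_append)
  also have "\<dots> = free_reduce ((X @ M @ s) @ (winv s @ Y))"
    by (rule free_reduce_append_cong) (simp_all flip: 1 Y(2))
  also have "\<dots> = X @ M @ Y"
    using free_reduce_cancelled[of "X @ M" Y s] red' by simp
  finally have 3: "free_reduce (f (x @ v @ y)) = X @ M @ Y" .
  show ?thesis using 1 2 3 X(2) M by (simp add: rlen_def)
qed

end

text \<open>\<open>loop v p\<close> says that \<open>p\<close> is a closed walk based at \<open>v\<close> in the graph of reduced words of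
  length \<open>\<bar>v\<bar>\<close>.\<close>

definition loop :: "word \<Rightarrow> word \<Rightarrow> bool" where
  "loop v p \<longleftrightarrow> reduced (p @ v) \<and> (\<exists>p'. p @ v = v @ p')"

text \<open>The reduced words \<open>p @ v\<close> and \<open>v @ q'\<close> overlap in the nonempty
  word \<open>v\<close> and can be glued along it.\<close>

lemma loop_append:
  assumes "loop v p" "loop v q" "v \<noteq> []" shows "loop v (p @ q)"
proof -
  obtain p' q' where *: "p @ v = v @ p'" "q @ v = v @ q'" and "reduced (p @ v)" "reduced (v @ q')"
    using assms by (auto simp: loop_def)
  then have "reduced (p @ v @ q')" using \<open>v \<noteq> []\<close> by (intro reduced_overlap)
  moreover have "(p @ q) @ v = v @ p' @ q'" using * by (metis append_assoc)
  moreover have "reduced ((p @ q) @ v)" using \<open>reduced (p @ v @ q')\<close> * by simp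
  ultimately show ?thesis unfolding loop_def by blast
qed

lemma loop_wpow: "loop v p \<Longrightarrow> v \<noteq> [] \<Longrightarrow> loop v (wpow p n)"
proof (induction n)
  case 0
  then show ?case by (auto simp: loop_def reduced_append)
qed (auto intro: loop_append)

text \<open>Since \<open>p @ v\<close> starts with \<open>v\<close>, the words \<open>p\<close> and
  \<open>v\<close> share their first letter. Hence the junction of \<open>p\<close> with
  \<open>v\<close> is the same as that of \<open>p\<close> with itself.\<close>

lemma loop_cyclically_reduced:
  assumes "loop v p" "v \<noteq> []" shows "cyclically_reduced p"
proof (cases "p = []")
  case False
  obtain p' where "p @ v = v @ p'" "reduced (p @ v)"
    using assms by (auto simp: loop_def)
  moreover from this have "hd p = hd v" using False assms(2) by (metis hd_append2)
  moreover have "reduced p \<and> hd v \<noteq> inv_letter (last p)"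
    using \<open>reduced (p @ v)\<close> False assms(2) unfolding reduced_append by blast
  ultimately show ?thesis by (simp add: cyclically_reduced_def)
qed (simp add: cyclically_reduced_def)

text \<open>A word commutes with its powers. Every nonempty cyclically reduced word thereby becomes
  a loop at a window of any desired length.\<close>

lemma loop_self_power:
  assumes "cyclically_reduced p" shows "loop (wpow p n) p"
  using reduced_wpow[OF assms, of "Suc n"] wpow_Suc_right[of p n] by (auto simp: loop_def)

context bilipschitz
begin

lemma image_length_loop_append:
  assumes "loop v p" "loop v q" "word_over k v" "word_over k p" "word_over k q"
    "window_len m \<le> length v"
  shows "rlen (f ((p @ q) @ v)) + rlen (f v) = rlen (f (p @ v)) + rlen (f (q @ v))"
proof -
  obtain q' where q': "q @ v = v @ q'" "reduced (v @ q')" "reduced (p @ v)"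
    using assms(1,2) by (auto simp: loop_def)
  moreover have "word_over k q'" using q'(1) assms(3,5) by (metis word_over_append)
  ultimately show ?thesis
    using image_length_additive[of p v q'] assms(3,4,6) by simp
qed

lemma window_pos: "window_len m \<le> length v \<Longrightarrow> v \<noteq> []"
  using m_pos by (auto simp: window_len_def)

text \<open>Each further turn around \<open>p\<close> lengthens the image of
  \<open>wpow p n @ v\<close> by the same amount, and dropping \<open>v\<close> costs a bounded
  error, so this amount is the growth rate. The word \<open>f p\<close> itself may be far from
  cyclically reduced.\<close>

lemma cyc_len_image_loop:
  assumes "loop v p" "word_over k v" "word_over k p" "window_len m \<le> length v"
  shows "int (cyc_len (f p)) = int (rlen (f (p @ v))) - int (rlen (f v))" (is "_ = ?c")
proof (rule cyc_len_eqI)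
  fix n
  have "int (rlen (f (wpow p n @ v))) = int (rlen (f v)) + int n * ?c"
  proof (induction n)
    case (Suc n)
    have "loop v (wpow p n)" "word_over k (wpow p n)"
      using loop_wpow[OF assms(1) window_pos[OF assms(4)]] word_over_wpow assms(3) by auto
    from image_length_loop_append[OF assms(1) this(1) assms(2,3) this(2) assms(4)] Suc
    show ?case by (simp add: algebra_simps)
  qed simp
  moreover have "\<bar>int (rlen (wpow (f p) n)) - int (rlen (f (wpow p n @ v)))\<bar> \<le> int (rlen (f v))"
    using rlen_append[of "wpow (f p) n" "f v"] rlen_left_le[of "wpow (f p) n" "f v"]
    by (simp add: f_append f_wpow)
  ultimately show "\<bar>int (rlen (wpow (f p) n)) - int n * ?c\<bar> \<le> 2 * int (rlen (f v))"
    by linarith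
qed

lemma cyc_len_image_loop_append:
  assumes "loop v p" "loop v q" "word_over k v" "word_over k p" "word_over k q"
    "window_len m \<le> length v"
  shows "cyc_len (f (p @ q)) = cyc_len (f p) + cyc_len (f q)"
proof -
  have "loop v (p @ q)" "word_over k (p @ q)"
    using loop_append[OF assms(1,2) window_pos[OF assms(6)]] assms(4,5) by auto
  from cyc_len_image_loop[OF this(1) assms(3) this(2) assms(6)]
  show ?thesis
    using cyc_len_image_loop[OF assms(1,3,4,6)] cyc_len_image_loop[OF assms(2,3,5,6)]
      image_length_loop_append[OF assms] by simp
qed

end

section \<open>Extremal and intermediate ratios\<close>

lemma reduced_take_drop:
  assumes "reduced w" shows "reduced (take n (drop i w))"
proof -
  have "w = take i w @ take n (drop i w) @ drop n (drop i w)"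
    by (simp only: append_take_drop_id)
  then show ?thesis using assms by (metis reduced_append)
qed

text \<open>The segment of \<open>W\<close> from the start of the first window to the end of the
  second both begins and ends with \<open>v\<close>. The two occurrences may overlap.\<close>

lemma loop_between_equal_windows:
  assumes "reduced W" "take L (drop i W) = v" "take L (drop j W) = v" "i \<le> j"
  shows "loop v (take (j - i) (drop i W))"
proof -
  have "take (j - i) (drop i W) @ v = take (j - i + L) (drop i W)"
    using assms(3,4) by (simp only: take_add drop_drop) simp
  moreover have "take (j - i + L) (drop i W) = v @ take (j - i) (drop L (drop i W))"
    using assms(2) by (subst add.commute) (simp add: take_add)
  ultimately show ?thesis
    using reduced_take_drop[OF assms(1), of "j - i + L" i] by (auto simp: loop_def)
qed

text \<open>The number \<open>(2 * k) ^ L\<close> counts all words of length \<open>L\<close>,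
  reduced or not, so two starting positions within one period see the same window and cut the period
  into two loops.\<close>

lemma cyclic_word_splits:
  assumes w: "cyclically_reduced w" "word_over k w" and long: "(2 * k) ^ L < length w"
  obtains v p q i where "length v = L" "loop v p" "loop v q" "p \<noteq> []" "q \<noteq> []"
    "word_over k v" "p @ q = drop i w @ take i w"
proof -
  let ?n = "length w"
  \<comment> \<open>Two copies of \<open>w\<close> hold all starting positions up to
    \<open>2 * ?n\<close>, and the other \<open>L\<close> copies have at least \<open>L\<close>
    letters, so that every window fits.\<close>
  define W where "W = wpow w (L + 2)"
  define win where "win i = take L (drop i W)" for i
  have n: "Suc 0 \<le> ?n" using long by linarith
  then have "L * 1 \<le> L * ?n" by (intro mult_le_mono2) simp
  then have lenW: "L + 2 * ?n \<le> length W" by (simp add: W_def)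
  have W1: "W = w @ wpow w (L + 1)" "W = wpow w (L + 1) @ w" "W = w @ w @ wpow w L"
    using wpow_Suc_right[of w "L + 1"] by (simp_all add: W_def)
  have redW: "reduced W" unfolding W_def by (rule reduced_wpow[OF w(1)])
  have overW: "word_over k W" using w(2) by (simp add: W_def word_over_wpow)
  have win_over: "word_over k (win i)" for i
    unfolding win_def
    by (rule word_over_subset[OF _ overW]) (metis set_drop_subset set_take_subset subset_trans)
  have win_len: "length (win i) = L" if "i \<le> ?n" for i
    using that lenW by (simp add: win_def)
  let ?X = "{xs :: word. set xs \<subseteq> {..<k} \<times> UNIV \<and> length xs = L}"
  have "finite ({..<k} \<times> (UNIV :: bool set))" by simp
  then have X: "finite ?X" "card ?X = (2 * k) ^ L"
    using finite_lists_length_eq[of "{..<k} \<times> (UNIV :: bool set)" L]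
      card_lists_length_eq[of "{..<k} \<times> (UNIV :: bool set)" L]
    by (simp_all add: card_cartesian_product mult.commute)
  have "win ` {..<?n} \<subseteq> ?X"
    using win_over[unfolded word_over_iff_set] win_len by (simp add: image_subset_iff)
  then have "card (win ` {..<?n}) < card {..<?n}"
    using card_mono[OF X(1), of "win ` {..<?n}"] X(2) long by simp
  then have "\<not> inj_on win {..<?n}" by (rule pigeonhole)
  then obtain i j where ij: "i < j" "j < ?n" "win i = win j"
    unfolding inj_on_def by (metis lessThan_iff linorder_neqE_nat)
  define v where "v = win i"
  \<comment> \<open>Periodicity: the window at \<open>?n + i\<close> is the window at
    \<open>i\<close> after removal of the first copy of \<open>w\<close>, and the window at
    \<open>i\<close> does not reach the last copy.\<close>
  have "take L (drop (?n + i) W) = take L (drop i (wpow w (L + 1)))"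
    by (simp only: W1(1) drop_append) simp
  also have "\<dots> = take L (drop i W)"
  proof -
    have "i + L \<le> length (wpow w (L + 1))"
      using add_mono[of i ?n L "L * ?n"] ij n by simp
    then show ?thesis by (simp only: W1(2) drop_append take_append) simp
  qed
  finally have v: "take L (drop i W) = v" "take L (drop j W) = v" "take L (drop (?n + i) W) = v"
    using ij by (auto simp: v_def win_def)
  \<comment> \<open>The loop \<open>p\<close> runs from \<open>i\<close> to \<open>j\<close>, and
    \<open>q\<close> runs on from \<open>j\<close> to the repetition of \<open>i\<close> one period
    later.\<close>
  define p q where "p = take (j - i) (drop i W)" and "q = take (?n + i - j) (drop j W)"
  have "loop v p" "loop v q"
    unfolding p_def q_def using ij by (auto intro!: loop_between_equal_windows redW v)
  moreover have "p \<noteq> []" "q \<noteq> []" using ij lenW by (auto simp: p_def q_def)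
  moreover have "p @ q = drop i w @ take i w"
  proof -
    have "p @ q = take (j - i + (?n + i - j)) (drop i W)"
      using ij unfolding p_def q_def take_add by simp
    then show ?thesis using ij by (simp add: W1(3))
  qed
  ultimately show thesis
    using that[of v p q i] win_len[of i] win_over ij by (auto simp: v_def)
qed

context bilipschitz
begin

lemma cyc_len_image_rotate: "cyc_len (f (u @ v)) = cyc_len (f (v @ u))"
  by (simp add: f_append cyc_len_rotate)

lemma cyc_len_image_conj: "cyc_len (f (h @ u @ winv h)) = cyc_len (f u)"
proof -
  have "cyc_len (f (h @ u @ winv h)) = cyc_len (f h @ f u @ winv (f h))"
    by (rule cyc_len_cong) (auto simp: f_append f_winv free_reduce_winv intro!: free_reduce_append_cong)
  then show ?thesis by (simp add: cyc_len_conj)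
qed

text \<open>Every rational bound on \<open>cyc_len (f w) / cyc_len w\<close> has the form \<open>0 \<le> weight s t w\<close>.\<close>

definition weight :: "int \<Rightarrow> int \<Rightarrow> word \<Rightarrow> int" where
  "weight s t w = s * int (cyc_len (f w)) + t * int (cyc_len w)"

lemma weight_cyclic_representative:
  assumes "word_over k w"
  obtains u where "cyclically_reduced u" "word_over k u" "cyc_len w = length u"
    "\<And>s t. weight s t w = weight s t u"
proof -
  obtain h u where u: "free_reduce w = h @ u @ winv h" "cyclically_reduced u" "length u = cyc_len w"
    by (rule free_reduce_cyclic)
  have "cyc_len (f w) = cyc_len (f u)"
    using cyc_len_cong[OF f_reduce, of w] cyc_len_image_conj[of h u] u(1) by simp
  moreover have "word_over k u"
    using word_over_free_reduce[OF assms] u(1) by simp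
  ultimately show thesis using that u by (simp add: weight_def cyc_len_cyclic)
qed

lemma weight_loop_append:
  assumes "loop v p" "loop v q" "word_over k v" "word_over k p" "word_over k q"
    "window_len m \<le> length v"
  shows "weight s t (p @ q) = weight s t p + weight s t q"
proof -
  have v: "v \<noteq> []" by (rule window_pos[OF assms(6)])
  have "cyc_len (p @ q) = cyc_len p + cyc_len q"
    using assms(1,2) loop_append[OF assms(1,2) v] v
    by (simp add: cyc_len_cyclic loop_cyclically_reduced)
  then show ?thesis
    using cyc_len_image_loop_append[OF assms] by (simp add: weight_def algebra_simps)
qed

lemma weight_rotate: "weight s t (u @ v) = weight s t (v @ u)"
  by (simp add: weight_def cyc_len_image_rotate cyc_len_rotate)

lemma weight_wpow: "weight s t (wpow w n) = int n * weight s t w"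
  by (simp add: weight_def f_wpow cyc_len_wpow algebra_simps)

text \<open>Strong induction on cyclically reduced words: a word longer than the number of windows
  is, up to rotation, a product of two shorter nonempty loops at one window, whose weights
  add.\<close>

lemma weight_nonneg:
  assumes short: "\<And>u. word_over k u \<Longrightarrow> length u \<le> (2 * k) ^ window_len m \<Longrightarrow> 0 \<le> weight s t u"
    and over: "word_over k w"
  shows "0 \<le> weight s t w"
proof -
  have "0 \<le> weight s t u" if "cyclically_reduced u" "word_over k u" for u
    using that
  proof (induction u rule: length_induct)
    case (1 u)
    show ?case
    proof (cases "length u \<le> (2 * k) ^ window_len m")
      case False
      then obtain v p q i where *: "length v = window_len m" "loop v p" "loop v q" "p \<noteq> []" "q \<noteq> []"
        "word_over k v" "p @ q = drop i u @ take i u"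
        using cyclic_word_splits[OF 1(2,3), of "window_len m"] by (metis not_le)
      have "set (p @ q) \<subseteq> set u"
        unfolding *(7) using set_drop_subset[of i u] set_take_subset[of i u] by simp
      then have over: "word_over k p" "word_over k q"
        using word_over_subset[OF _ 1(3), of "p @ q"] by simp_all
      have "length p + length q = length u"
        using arg_cong[OF *(7), of length] by simp
      then have "length p < length u" "length q < length u"
        using *(4,5) by (auto simp flip: length_greater_0_conv)
      moreover have "cyclically_reduced p" "cyclically_reduced q"
        using *(1-3) loop_cyclically_reduced[of v] window_pos[of v] by simp_all
      ultimately have "0 \<le> weight s t p" "0 \<le> weight s t q"
        using 1(1) over by auto
      moreover have "weight s t u = weight s t (p @ q)"
        using weight_rotate[of s t "take i u" "drop i u"] *(7) by simp
      ultimately show ?thesis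
        using weight_loop_append[OF *(2,3,6) over] *(1) by simp
    qed (use 1 short in auto)
  qed
  then show ?thesis
    using weight_cyclic_representative[OF over] by metis
qed

end

section \<open>Rationals between two ratios\<close>

lemma connecting_letter:
  assumes "2 \<le> k"
  obtains x where "fst x < k" "x \<noteq> inv_letter a" "b \<noteq> inv_letter x"
proof -
  \<comment> \<open>At most two letters are excluded, and the second basis element supplies a third
    candidate.\<close>
  have "\<exists>x \<in> {(0, True), (0, False), (1, True)}. x \<noteq> inv_letter a \<and> x \<noteq> inv_letter b"
    by (cases "inv_letter a"; cases "inv_letter b") auto
  then obtain x where "x \<in> {(0, True), (0, False), (1, True)}" "x \<noteq> inv_letter a" "x \<noteq> inv_letter b"
    by blast
  moreover from this have "fst x < k" "b \<noteq> inv_letter x" using assms by auto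
  ultimately show thesis using that[of x] by blast
qed

context bilipschitz
begin

text \<open>From a word of negative and a word of positive weight one obtains two loops at the same base
  point with weights \<open>-A < 0 < B\<close>; going \<open>B\<close> times around the first one and \<open>A\<close> times around the
  second one gives weight \<open>0\<close>.\<close>

lemma weight_intermediate:
  assumes "2 \<le> k" and over: "word_over k \<alpha>" "word_over k \<beta>"
    and neg: "weight s t \<alpha> < 0" and pos: "0 < weight s t \<beta>"
  obtains w where "word_over k w" "cyc_len w \<noteq> 0" "weight s t w = 0"
proof -
  obtain \<alpha>' where \<alpha>': "cyclically_reduced \<alpha>'" "word_over k \<alpha>'" "weight s t \<alpha>' < 0"
    using weight_cyclic_representative[OF over(1)] neg by metis
  obtain \<beta>' where \<beta>': "cyclically_reduced \<beta>'" "word_over k \<beta>'" "0 < weight s t \<beta>'"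
    using weight_cyclic_representative[OF over(2)] pos by metis
  have ne: "\<alpha>' \<noteq> []" "\<beta>' \<noteq> []"
    using \<alpha>'(3) \<beta>'(3) by (auto simp: weight_def cyc_len_def)
  let ?L = "window_len m"
  have L: "0 < ?L" using window_pos[of "[]"] by (cases ?L) auto
  \<comment> \<open>Powers serve as base windows because they are long enough and carry
    \<open>\<alpha>'\<close> and \<open>\<beta>'\<close> as loops.\<close>
  define v1 v2 where "v1 = wpow \<alpha>' ?L" and "v2 = wpow \<beta>' ?L"
  have v_ne: "v1 \<noteq> []" "v2 \<noteq> []" using ne L by (simp_all add: v1_def v2_def)
  have v_long: "?L \<le> length v1" "?L \<le> length v2"
    using ne by (simp_all add: v1_def v2_def length_wpow_ge del: length_wpow)
  have v_over: "word_over k v1" "word_over k v2"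
    using \<alpha>'(2) \<beta>'(2) by (simp_all add: v1_def v2_def word_over_wpow)
  obtain x where x: "fst x < k" "x \<noteq> inv_letter (last v1)" "hd v2 \<noteq> inv_letter x"
    by (rule connecting_letter[OF assms(1)])
  obtain y where y: "fst y < k" "y \<noteq> inv_letter (last v2)" "hd v1 \<noteq> inv_letter y"
    by (rule connecting_letter[OF assms(1)])
  have red: "reduced v1" "reduced v2"
    using \<alpha>'(1) \<beta>'(1) by (simp_all add: v1_def v2_def reduced_wpow)
  \<comment> \<open>A round trip from \<open>v2\<close> through \<open>v1\<close> and back to
    \<open>v2\<close>, of unknown weight.\<close>
  define \<rho> where "\<rho> = v2 @ [y] @ v1 @ [x]"
  have loop_\<rho>: "loop v2 \<rho>"
  proof -
    have "reduced (v2 @ y # v1)" "reduced (v1 @ x # v2)"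
      using red x y v_ne by (auto intro: reduced_connect)
    then have "reduced ((v2 @ [y]) @ v1 @ x # v2)"
      using v_ne by (intro reduced_overlap) auto
    then show ?thesis by (auto simp: loop_def \<rho>_def)
  qed
  have loop_\<beta>: "loop v2 (wpow \<beta>' j)" for j
    using loop_self_power[OF \<beta>'(1)] v_ne by (simp add: v2_def loop_wpow)
  have loop_\<alpha>: "loop v1 (wpow \<alpha>' j)" for j
    using loop_self_power[OF \<alpha>'(1)] v_ne by (simp add: v1_def loop_wpow)
  have over': "word_over k \<rho>" "word_over k (wpow \<beta>' j)" "word_over k (wpow \<alpha>' j)" for j
    using v_over x y \<alpha>'(2) \<beta>'(2) by (simp_all add: \<rho>_def word_over_wpow)
  \<comment> \<open>Each copy of \<open>\<beta>'\<close> has weight at least 1, so \<open>j\<close>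
    copies outweigh the round trip even if its weight is negative.\<close>
  define j where "j = Suc (nat \<bar>weight s t \<rho>\<bar>)"
  \<comment> \<open>This is a rotation of \<open>wpow \<beta>' j @ \<rho>\<close> that starts at
    \<open>v1\<close>: its weight is computed at the base \<open>v2\<close>, but it can be combined
    with \<open>\<alpha>'\<close> at the base \<open>v1\<close>.\<close>
  define \<gamma> where "\<gamma> = v1 @ [x] @ wpow \<beta>' j @ v2 @ [y]"
  have "weight s t \<gamma> = weight s t (wpow \<beta>' j @ \<rho>)"
    using weight_rotate[of s t "v1 @ [x]" "wpow \<beta>' j @ v2 @ [y]"] by (simp add: \<gamma>_def \<rho>_def)
  also have "\<dots> = int j * weight s t \<beta>' + weight s t \<rho>"
    using weight_loop_append[OF loop_\<beta> loop_\<rho> v_over(2) over'(2,1) v_long(2)]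
    by (simp add: weight_wpow)
  also have "\<dots> > 0"
  proof -
    have "int j * 1 \<le> int j * weight s t \<beta>'" using \<beta>'(3) by (intro mult_left_mono) auto
    then show ?thesis by (simp add: j_def)
  qed
  finally have \<gamma>: "0 < weight s t \<gamma>" .
  \<comment> \<open>The letter \<open>x\<close> was chosen to fit in front of \<open>v2\<close>; it
    still fits because \<open>wpow \<beta>' j @ v2\<close> has the same first letter.\<close>
  have hd_\<beta>: "hd (wpow \<beta>' j @ v2) = hd v2"
    using ne L by (simp add: hd_wpow v2_def j_def del: wpow_Suc)
  have red_\<beta>: "reduced (wpow \<beta>' j @ v2)"
    using loop_\<beta>[of j] by (simp add: loop_def)
  have red_x: "reduced (v1 @ x # (wpow \<beta>' j @ v2))"
    by (rule reduced_connect) (use red_\<beta> red x v_ne hd_\<beta> in simp_all)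
  have "reduced ((v1 @ x # (wpow \<beta>' j @ v2)) @ y # v1)"
    by (rule reduced_connect) (use red_x red y v_ne in simp_all)
  then have "loop v1 \<gamma>"
    by (auto simp: loop_def \<gamma>_def)
  then have loop_\<gamma>: "loop v1 (wpow \<gamma> n)" for n
    using v_ne by (intro loop_wpow)
  have over_\<gamma>: "word_over k (wpow \<gamma> n)" for n
    using v_over x y over' by (intro word_over_wpow) (simp add: \<gamma>_def)
  define A B where "A = nat (- weight s t \<alpha>')" and "B = nat (weight s t \<gamma>)"
  define w where "w = wpow \<alpha>' B @ wpow \<gamma> A"
  have "weight s t w = int B * weight s t \<alpha>' + int A * weight s t \<gamma>"
    using weight_loop_append[OF loop_\<alpha> loop_\<gamma> v_over(1) over'(3) over_\<gamma> v_long(1)]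
    by (simp add: w_def weight_wpow)
  then have "weight s t w = 0"
    using \<alpha>'(3) \<gamma> by (simp add: A_def B_def)
  moreover have "word_over k w" using over' over_\<gamma> by (simp add: w_def)
  moreover have "cyc_len w \<noteq> 0"
  proof -
    have "cyclically_reduced w"
      using loop_cyclically_reduced[OF loop_append[OF loop_\<alpha> loop_\<gamma>]] v_ne by (simp add: w_def)
    moreover have "w \<noteq> []" using ne \<gamma> by (simp add: w_def B_def)
    ultimately show ?thesis by (simp add: cyc_len_cyclic)
  qed
  ultimately show thesis using that by blast
qed

end

section \<open>The ratios as a rational interval\<close>

context bilipschitz
begin

lemma cyc_len_image_eq_0_iff:
  assumes "word_over k w" shows "cyc_len (f w) = 0 \<longleftrightarrow> cyc_len w = 0"
proof
  assume "cyc_len (f w) = 0"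
  then have "rlen w = 0" using f_lower[OF assms] by (simp add: cyc_len_eq_0_iff rlen_def)
  then show "cyc_len w = 0" by (simp add: cyc_len_eq_0_iff rlen_def)
next
  assume "cyc_len w = 0"
  then show "cyc_len (f w) = 0" using f_cong[of w "[]"] by (simp add: cyc_len_eq_0_iff)
qed

definition ratio :: "word \<Rightarrow> rat" where
  "ratio w = of_nat (cyc_len (f w)) / of_nat (cyc_len w)"

lemma ratio_pos:
  assumes "word_over k w" "cyc_len w \<noteq> 0" shows "0 < ratio w"
proof -
  have "cyc_len (f w) \<noteq> 0" using assms by (simp add: cyc_len_image_eq_0_iff)
  then show ?thesis using assms(2) by (simp add: ratio_def)
qed

lemma weight_eq_ratio:
  "cyc_len w \<noteq> 0 \<Longrightarrow> of_int (weight s t w) = (of_int s * ratio w + of_int t) * of_nat (cyc_len w)"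
  by (simp add: weight_def ratio_def field_simps)

lemma ratio_bounds:
  assumes short: "\<And>u. word_over k u \<Longrightarrow> length u \<le> (2 * k) ^ window_len m \<Longrightarrow> cyc_len u \<noteq> 0 \<Longrightarrow>
      0 \<le> weight s t u"
    and w: "word_over k w" "cyc_len w \<noteq> 0"
  shows "0 \<le> of_int s * ratio w + of_int t"
proof -
  \<comment> \<open>Trivial elements have both lengths 0 and hence weight 0, so the assumption on
    nontrivial words extends to all short words.\<close>
  have "0 \<le> weight s t u" if u: "word_over k u" "length u \<le> (2 * k) ^ window_len m" for u
    using short[OF u] cyc_len_image_eq_0_iff[OF u(1)] by (cases "cyc_len u = 0") (auto simp: weight_def)
  then have "0 \<le> weight s t w" using w(1) by (rule weight_nonneg)
  then have "0 \<le> (of_int s * ratio w + of_int t) * of_nat (cyc_len w)"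
    by (simp flip: weight_eq_ratio[OF w(2)])
  then show ?thesis using w(2) by (simp add: zero_le_mult_iff)
qed

text \<open>The products in \<open>short\<close> are ratio inequalities cleared of denominators,
  that is, nonnegativity on short words of two weights whose coefficients are the lengths belonging
  to \<open>wa\<close> and \<open>wb\<close>.\<close>

lemma ratio_spectrum:
  assumes "2 \<le> k"
    and a: "word_over k wa" "cyc_len wa \<noteq> 0" and b: "word_over k wb" "cyc_len wb \<noteq> 0"
    and short: "\<And>u. word_over k u \<Longrightarrow> length u \<le> (2 * k) ^ window_len m \<Longrightarrow> cyc_len u \<noteq> 0 \<Longrightarrow>
      cyc_len (f wa) * cyc_len u \<le> cyc_len (f u) * cyc_len wa \<and>
      cyc_len (f u) * cyc_len wb \<le> cyc_len (f wb) * cyc_len u"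
  shows "ratio ` {w. word_over k w \<and> cyc_len w \<noteq> 0} = {ratio wa .. ratio wb}"
proof (intro equalityI subsetI)
  fix r assume "r \<in> ratio ` {w. word_over k w \<and> cyc_len w \<noteq> 0}"
  then obtain w where w: "word_over k w" "cyc_len w \<noteq> 0" "r = ratio w" by auto
  have "0 \<le> weight (int (cyc_len wa)) (- int (cyc_len (f wa))) u"
    "0 \<le> weight (- int (cyc_len wb)) (int (cyc_len (f wb))) u"
    if u: "word_over k u" "length u \<le> (2 * k) ^ window_len m" "cyc_len u \<noteq> 0" for u
    using short[OF u] by (simp_all add: weight_def mult.commute flip: of_nat_mult)
  then have "0 \<le> of_int (int (cyc_len wa)) * ratio w + of_int (- int (cyc_len (f wa)))"
    "0 \<le> of_int (- int (cyc_len wb)) * ratio w + of_int (int (cyc_len (f wb)))"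
    using ratio_bounds[OF _ w(1,2)] by blast+
  then show "r \<in> {ratio wa .. ratio wb}"
    using a(2) b(2) w(3) by (simp add: ratio_def[of wa] ratio_def[of wb] field_simps)
next
  fix r assume r: "r \<in> {ratio wa .. ratio wb}"
  show "r \<in> ratio ` {w. word_over k w \<and> cyc_len w \<noteq> 0}"
  proof (cases "r = ratio wa \<or> r = ratio wb")
    case True
    then show ?thesis using a b by auto
  next
    case False
    obtain p q where pq: "r = of_int p / of_int q" "0 < q"
      by (metis Fract_of_int_quotient Rat_cases)
    \<comment> \<open>The weight with coefficients \<open>q\<close> and \<open>- p\<close> has the
      sign of \<open>ratio w - r\<close>, so ratio \<open>r\<close> means weight 0.\<close>
    have sign: "of_int (weight q (- p) w) = of_int q * (ratio w - r) * of_nat (cyc_len w)"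
      if "cyc_len w \<noteq> 0" for w
      using weight_eq_ratio[OF that, of q "- p"] pq by (simp add: field_simps)
    have "of_int (weight q (- p) wa) < (0 :: rat)" "(0 :: rat) < of_int (weight q (- p) wb)"
      unfolding sign[OF a(2)] sign[OF b(2)] using r False pq(2) a(2) b(2)
      by (simp_all add: mult_less_0_iff zero_less_mult_iff)
    then obtain w where w: "word_over k w" "cyc_len w \<noteq> 0" "weight q (- p) w = 0"
      using weight_intermediate[OF assms(1) a(1) b(1), of q "- p"] by auto
    then have "ratio w = r" using sign[OF w(2)] pq(2) by simp
    then show ?thesis using w by auto
  qed
qed

end

section \<open>Automorphisms as substitutions\<close>

definition letter_image :: "(nat \<Rightarrow> word) \<Rightarrow> letter \<Rightarrow> word" where
  "letter_image g x = (if snd x then winv (g (fst x)) else g (fst x))"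

definition subst :: "(nat \<Rightarrow> word) \<Rightarrow> word \<Rightarrow> word" where
  "subst g w = concat (map (letter_image g) w)"

lemma subst_Nil [simp]: "subst g [] = []"
  and subst_Cons [simp]: "subst g (x # w) = letter_image g x @ subst g w"
  and subst_append [simp]: "subst g (u @ v) = subst g u @ subst g v"
  by (simp_all add: subst_def)

lemma letter_image_inv_letter: "letter_image g (inv_letter x) = winv (letter_image g x)"
  by (simp add: letter_image_def inv_letter_def[of x])

lemma free_reduce_subst: "free_reduce (subst g (free_reduce w)) = free_reduce (subst g w)"
proof (induction w)
  case (Cons x w)
  let ?r = "free_reduce w"
  have "free_reduce (subst g (cancel_cons x ?r)) = free_reduce (subst g (x # ?r))"
  proof (cases ?r)
    case (Cons y ys)
    then show ?thesis
      using free_reduce_cancel(2)[of "[]" "letter_image g x" "subst g ys"]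
      by (simp add: letter_image_inv_letter)
  qed simp
  also have "\<dots> = free_reduce (subst g (x # w))"
    using Cons by (auto intro: free_reduce_append_cong)
  finally show ?case by (simp add: free_reduce_def)
qed simp

lemma subst_winv: "subst g (winv w) = winv (subst g w)"
  by (induction w) (auto simp: letter_image_inv_letter)

lemma word_over_subst:
  "(\<And>i. i < k \<Longrightarrow> word_over j (g i)) \<Longrightarrow> word_over k w \<Longrightarrow> word_over j (subst g w)"
  by (induction w) (auto simp: letter_image_def)

lemma length_subst:
  "(\<And>i. i < k \<Longrightarrow> length (g i) \<le> m) \<Longrightarrow> word_over k w \<Longrightarrow> length (subst g w) \<le> m * length w"
  by (induction w) (auto simp: letter_image_def add_mono)

lemma free_reduce_subst_subst:
  assumes "\<And>i. i < k \<Longrightarrow> free_reduce (subst g (h i)) = gen i" and "word_over k w"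
  shows "free_reduce (subst g (subst h w)) = free_reduce w"
  using assms(2)
proof (induction w)
  case (Cons x w)
  have "free_reduce (subst g (letter_image h x)) = [x]"
    using Cons.prems assms(1)[of "fst x"]
    by (cases x) (auto simp: letter_image_def subst_winv free_reduce_winv gen_def inv_letter_def)
  then have "free_reduce (subst g (subst h (x # w))) = free_reduce ([x] @ w)"
    unfolding subst_Cons subst_append
    by (intro free_reduce_append_cong) (use Cons in \<open>simp_all add: free_reduce_def\<close>)
  then show ?case by simp
qed simp

lemma carrier_free_grp: "w \<in> carrier (free_grp k) \<longleftrightarrow> reduced w \<and> word_over k w"
  by (simp add: free_grp_def word_over_def)

lemma mult_free_grp: "u \<otimes>\<^bsub>free_grp k\<^esub> v = free_reduce (u @ v)"
  and one_free_grp: "\<one>\<^bsub>free_grp k\<^esub> = []"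
  by (simp_all add: free_grp_def)

lemma inv_free_grp:
  assumes "w \<in> carrier (free_grp k)" shows "inv\<^bsub>free_grp k\<^esub> w = winv w"
  by (rule group.inv_equality[OF group_free_grp])
    (use assms in \<open>auto simp: carrier_free_grp mult_free_grp one_free_grp free_reduce_inverse
        reduced_inverse\<close>)

text \<open>The cyclic core is a witness. Uniqueness follows because \<open>cyc_len\<close> is
  invariant under conjugation and is the plain length of a cyclically reduced word.\<close>

lemma conj_length_eq_cyc_len:
  assumes "w \<in> carrier (free_grp k)" shows "conj_length k w = cyc_len w"
  unfolding conj_length_def
proof (rule the_equality)
  obtain h u where u: "free_reduce w = h @ u @ winv h" "cyclically_reduced u" "length u = cyc_len w"
    by (rule free_reduce_cyclic)
  then have w: "w = h @ u @ winv h"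
    using assms by (simp add: carrier_free_grp free_reduce_reduced)
  have "u \<in> carrier (free_grp k)" "winv h \<in> carrier (free_grp k)"
    using assms unfolding w by (auto simp: carrier_free_grp reduced_append)
  moreover have "u = winv h \<otimes>\<^bsub>free_grp k\<^esub> w \<otimes>\<^bsub>free_grp k\<^esub> inv\<^bsub>free_grp k\<^esub> (winv h)"
  proof -
    have "free_reduce (winv h @ w @ h) = free_reduce u"
      using free_reduce_cancel(1)[of "[]" h "u @ winv h @ h"] free_reduce_cancel(1)[of u h "[]"]
      by (simp add: w)
    then show ?thesis
      using u(2) \<open>winv h \<in> carrier (free_grp k)\<close>
      by (simp add: inv_free_grp mult_free_grp free_reduce_append_left cyclically_reduced_def
          free_reduce_reduced)
  qed
  ultimately show "\<exists>v\<in>carrier (free_grp k). cyclically_reduced v \<and> conj_in k w v \<and> cyc_len w = length v"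
    using u(2,3) unfolding conj_in_def by metis
next
  fix n assume "\<exists>v\<in>carrier (free_grp k). cyclically_reduced v \<and> conj_in k w v \<and> n = length v"
  then obtain v h where v: "cyclically_reduced v" "n = length v" "h \<in> carrier (free_grp k)"
    "v = h \<otimes>\<^bsub>free_grp k\<^esub> w \<otimes>\<^bsub>free_grp k\<^esub> inv\<^bsub>free_grp k\<^esub> h"
    by (auto simp: conj_in_def)
  then have "v = free_reduce (h @ w @ winv h)"
    by (simp add: inv_free_grp mult_free_grp free_reduce_append_left)
  then have "cyc_len v = cyc_len w" by (simp add: cyc_len_conj)
  then show "n = cyc_len w" using v(1,2) by (simp add: cyc_len_cyclic)
qed

text \<open>Allowing unreduced \<open>w\<close> makes it possible to apply \<phi> to the result of
  another substitution.\<close>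

lemma auto_eq_subst:
  assumes \<phi>: "\<phi> \<in> auto (free_grp k)" and "word_over k w"
  shows "\<phi> (free_reduce w) = free_reduce (subst (\<lambda>i. \<phi> (gen i)) w)"
  using assms(2)
proof -
  let ?G = "free_grp k"
  have hom: "\<phi> \<in> hom ?G ?G" using \<phi> by (simp add: auto_def)
  interpret group_hom ?G ?G \<phi>
    by (intro group_hom.intro group_hom_axioms.intro group_free_grp hom)
  have gen: "gen i \<in> carrier ?G" if "i < k" for i
    using that by (simp add: gen_def carrier_free_grp reduced_def)
  have letter: "[x] \<in> carrier ?G \<and> \<phi> [x] = letter_image (\<lambda>i. \<phi> (gen i)) x" if "fst x < k" for x
  proof (cases "snd x")
    case False
    then have "[x] = gen (fst x)" by (cases x) (simp add: gen_def)
    then show ?thesis using gen[OF that] False by (simp add: letter_image_def)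
  next
    case True
    then have x: "[x] = winv (gen (fst x))" by (cases x) (simp add: gen_def inv_letter_def)
    then have "[x] = inv\<^bsub>?G\<^esub> (gen (fst x))" using gen[OF that] by (simp add: inv_free_grp)
    then have "\<phi> [x] = inv\<^bsub>?G\<^esub> (\<phi> (gen (fst x)))"
      using gen[OF that] by simp
    then have "\<phi> [x] = winv (\<phi> (gen (fst x)))"
      using gen[OF that] by (simp add: inv_free_grp)
    moreover have "[x] \<in> carrier ?G" using that by (simp add: carrier_free_grp reduced_def)
    ultimately show ?thesis using True by (simp add: letter_image_def)
  qed
  show ?thesis using assms(2)
  proof (induction w)
    case Nil
    then show ?case using hom_one by (simp add: one_free_grp)
  next
    case (Cons x w)
    have carr: "[x] \<in> carrier ?G" "free_reduce w \<in> carrier ?G"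
      using Cons.prems letter by (auto simp: carrier_free_grp reduced_free_reduce word_over_free_reduce)
    have "\<phi> (free_reduce (x # w)) = \<phi> ([x] \<otimes>\<^bsub>?G\<^esub> free_reduce w)"
      using free_reduce_append_right[of "[x]" w] by (simp add: mult_free_grp)
    also have "\<dots> = free_reduce (\<phi> [x] @ \<phi> (free_reduce w))"
      using hom_mult[OF carr] by (simp only: mult_free_grp)
    also have "\<dots> = free_reduce (subst (\<lambda>i. \<phi> (gen i)) (x # w))"
      using Cons letter by (simp add: free_reduce_append_right)
    finally show ?case .
  qed
qed

text \<open>\<open>m\<close> bounds the images of the basis under the automorphism \<open>g\<close> and under its inverse.\<close>

definition bound_certificate :: "nat \<Rightarrow> (nat \<Rightarrow> word) \<Rightarrow> nat \<Rightarrow> bool" where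
  "bound_certificate k g m \<longleftrightarrow> (\<forall>i<k. length (g i) \<le> m \<and>
     (\<exists>u. word_over k u \<and> length u \<le> m \<and> free_reduce (subst g u) = gen i))"

lemma auto_image_carrier:
  assumes "\<phi> \<in> auto (free_grp k)" "i < k"
  shows "reduced (\<phi> (gen i)) \<and> word_over k (\<phi> (gen i))"
proof -
  have "gen i \<in> carrier (free_grp k)"
    using assms(2) by (simp add: gen_def carrier_free_grp reduced_def)
  then have "\<phi> (gen i) \<in> carrier (free_grp k)"
    using assms(1) by (auto simp: auto_def hom_def)
  then show ?thesis by (simp add: carrier_free_grp)
qed

lemma auto_generator_preimage:
  assumes \<phi>: "\<phi> \<in> auto (free_grp k)" and "i < k"
  obtains u where "word_over k u" "free_reduce (subst (\<lambda>i. \<phi> (gen i)) u) = gen i"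
proof -
  have "gen i \<in> carrier (free_grp k)"
    using assms(2) by (simp add: gen_def carrier_free_grp reduced_def)
  moreover have "\<phi> ` carrier (free_grp k) = carrier (free_grp k)"
    using \<phi> by (auto simp: auto_def Bij_def bij_betw_def)
  ultimately obtain u where "u \<in> carrier (free_grp k)" "\<phi> u = gen i" by (metis imageE)
  then show thesis
    using that[of u] auto_eq_subst[OF \<phi>, of u] by (simp add: carrier_free_grp free_reduce_reduced)
qed

text \<open>The preimages \<open>U i\<close> define a substitution inverting \<phi>: applied to the
  reduced image of \<open>w\<close>, it returns \<open>w\<close> up to reduction, by injectivity of
  \<phi>, and lengthens words at most by the factor \<open>m\<close>. This is the lower
  bound.\<close>

lemma bilipschitz_subst:
  assumes \<phi>: "\<phi> \<in> auto (free_grp k)" and "0 < k"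
    and cert: "bound_certificate k (\<lambda>i. \<phi> (gen i)) m"
  shows "bilipschitz k m (subst (\<lambda>i. \<phi> (gen i)))"
proof
  let ?g = "\<lambda>i. \<phi> (gen i)"
  obtain U where U: "word_over k (U i)" "length (U i) \<le> m" "free_reduce (subst ?g (U i)) = gen i"
    if "i < k" for i
    using cert unfolding bound_certificate_def by metis
  show "subst ?g (x @ y) = subst ?g x @ subst ?g y" for x y by simp
  show "free_reduce (subst ?g (free_reduce w)) = free_reduce (subst ?g w)" for w
    by (rule free_reduce_subst)
  show "rlen (subst ?g [l]) \<le> m" if "fst l < k" for l
  proof -
    have "rlen (subst ?g [l]) \<le> length (letter_image ?g l)"
      using rlen_le_length[of "letter_image ?g l"] by simp
    also have "\<dots> \<le> m"
      using that cert by (auto simp: letter_image_def bound_certificate_def)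
    finally show ?thesis .
  qed
  \<comment> \<open>For \<open>m = 0\<close> the word \<open>U 0\<close> would be empty and could
    not reduce to \<open>gen 0\<close>.\<close>
  show "0 < m"
    using U(2,3)[of 0] \<open>0 < k\<close> by (cases "m = 0") (auto simp: gen_def)
  show "rlen w \<le> m * rlen (subst ?g w)" if w: "word_over k w" for w
  proof -
    let ?z = "free_reduce (subst ?g w)"
    have z: "word_over k ?z"
      using word_over_subst[of k k ?g w] auto_image_carrier[OF \<phi>] w
      by (intro word_over_free_reduce) simp
    then have z': "word_over k (subst U ?z)"
      by (intro word_over_subst[of k k U] U(1))
    have "\<phi> (free_reduce (subst U ?z)) = free_reduce (subst ?g (subst U ?z))"
      by (rule auto_eq_subst[OF \<phi> z'])
    also have "\<dots> = \<phi> (free_reduce w)"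
      using free_reduce_subst_subst[OF U(3) z] auto_eq_subst[OF \<phi> w] by simp
    finally have "free_reduce (subst U ?z) = free_reduce w"
      using \<phi> z' w unfolding auto_def Bij_def bij_betw_def
      by (auto simp: carrier_free_grp reduced_free_reduce word_over_free_reduce dest!: inj_onD)
    then have "rlen w \<le> length (subst U ?z)"
      using rlen_cong rlen_le_length by metis
    also have "\<dots> \<le> m * length ?z" by (rule length_subst[OF U(2) z])
    finally show ?thesis by (simp add: rlen_def)
  qed
qed

lemma distortion_spectrum_eq:
  assumes \<phi>: "\<phi> \<in> auto (free_grp k)"
  shows "distortion_spectrum k \<phi> =
    {real (cyc_len (subst (\<lambda>i. \<phi> (gen i)) w)) / real (cyc_len w) | w. word_over k w \<and> cyc_len w \<noteq> 0}"
    (is "_ = ?R")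
proof -
  have *: "conj_length k (\<phi> w) = cyc_len (subst (\<lambda>i. \<phi> (gen i)) w)" "conj_length k w = cyc_len w"
    "cyc_len w \<noteq> 0 \<longleftrightarrow> w \<noteq> []" if w: "w \<in> carrier (free_grp k)" for w
  proof -
    have "\<phi> w \<in> carrier (free_grp k)" using \<phi> w by (auto simp: auto_def hom_def)
    moreover have "\<phi> w = free_reduce (subst (\<lambda>i. \<phi> (gen i)) w)"
      using auto_eq_subst[OF \<phi>, of w] w by (simp add: carrier_free_grp free_reduce_reduced)
    ultimately show "conj_length k (\<phi> w) = cyc_len (subst (\<lambda>i. \<phi> (gen i)) w)"
      using conj_length_eq_cyc_len by (metis cyc_len_free_reduce)
    show "conj_length k w = cyc_len w" using w by (rule conj_length_eq_cyc_len)
    show "cyc_len w \<noteq> 0 \<longleftrightarrow> w \<noteq> []"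
      using w by (simp add: cyc_len_eq_0_iff carrier_free_grp free_reduce_reduced)
  qed
  show ?thesis
  proof (intro equalityI subsetI)
    fix r assume "r \<in> distortion_spectrum k \<phi>"
    then show "r \<in> ?R"
      using * by (auto simp: distortion_spectrum_def one_free_grp carrier_free_grp)
  next
    fix r assume "r \<in> ?R"
    then obtain w where w: "r = real (cyc_len (subst (\<lambda>i. \<phi> (gen i)) w)) / real (cyc_len w)"
      "word_over k w" "cyc_len w \<noteq> 0" by blast
    let ?w = "free_reduce w"
    have carr: "?w \<in> carrier (free_grp k)"
      using w(2) by (simp add: carrier_free_grp reduced_free_reduce word_over_free_reduce)
    have "?w \<noteq> []" using w(3) by (simp add: cyc_len_eq_0_iff)
    moreover have "r = real (conj_length k (\<phi> ?w)) / real (conj_length k ?w)"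
      using *(1,2)[OF carr] w(1) cyc_len_cong[OF free_reduce_subst] by simp
    ultimately show "r \<in> distortion_spectrum k \<phi>"
      using carr unfolding distortion_spectrum_def one_free_grp by blast
  qed
qed

section \<open>Computable functions\<close>

definition computable :: "nat \<Rightarrow> (nat list \<Rightarrow> nat) \<Rightarrow> bool" where
  "computable n f \<longleftrightarrow> (\<exists>p. \<forall>xs. length xs = n \<longrightarrow> evaluates p xs (f xs))"

definition decidable :: "nat \<Rightarrow> (nat list \<Rightarrow> bool) \<Rightarrow> bool" where
  "decidable n P \<longleftrightarrow> computable n (\<lambda>xs. of_bool (P xs))"

text \<open>In the rules for recursion, quantifiers and folds the bound variable becomes a new first
  argument, so it is \<open>hd ys\<close> in the body and the former arguments are \<open>tl ys\<close>.\<close>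

named_theorems computable_intros

lemma computable_cong:
  "computable n f \<Longrightarrow> (\<And>xs. length xs = n \<Longrightarrow> f xs = g xs) \<Longrightarrow> computable n g"
  unfolding computable_def by metis

lemma computable_hd [computable_intros]: "0 < n \<Longrightarrow> computable n (\<lambda>xs. hd xs)"
  unfolding computable_def
  by (intro exI[of _ "Proj 0"]) (metis evaluates.intros(3) hd_conv_nth length_0_conv less_numeral_extra(3))

lemma computable_reindex:
  assumes "computable (length js) f" "\<And>j. j \<in> set js \<Longrightarrow> j < n"
  shows "computable n (\<lambda>xs. f (map ((!) xs) js))"
proof -
  obtain p where p: "\<And>xs. length xs = length js \<Longrightarrow> evaluates p xs (f xs)"
    using assms(1) by (auto simp: computable_def)
  have "evaluates (Comp p (map Proj js)) xs (f (map ((!) xs) js))" if "length xs = n" for xs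
    using that assms(2) by (intro evaluates.intros(4)[where ys = "map ((!) xs) js"] p)
      (auto simp: list_all2_conv_all_nth intro!: evaluates.intros(3))
  then show ?thesis unfolding computable_def by blast
qed

lemma computable_tl:
  assumes "computable n f" shows "computable (Suc n) (\<lambda>xs. f (tl xs))"
proof (rule computable_cong)
  show "computable (Suc n) (\<lambda>xs. f (map ((!) xs) [1..<Suc n]))"
    by (rule computable_reindex) (use assms in \<open>auto simp del: upt_Suc\<close>)
qed (auto simp: list_eq_iff_nth_eq nth_tl intro!: arg_cong[of _ _ f] simp del: upt_Suc)

text \<open>Primitive recursion puts the counter and the accumulator in front of the parameters; a
  function of the counter and the parameters is adapted to this order by ignoring the
  accumulator.\<close>

lemma computable_skip:
  assumes "computable (Suc n) (\<lambda>ys. f (hd ys) (tl ys))"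
  shows "computable (Suc (Suc n)) (\<lambda>ys. f (hd ys) (tl (tl ys)))"
proof (rule computable_cong)
  let ?g = "\<lambda>ys. f (hd ys) (tl ys)"
  show "computable (Suc (Suc n)) (\<lambda>xs. ?g (map ((!) xs) (0 # [2..<Suc (Suc n)])))"
    by (rule computable_reindex) (use assms in \<open>auto simp del: upt_Suc\<close>)
  fix xs :: "nat list" assume "length xs = Suc (Suc n)"
  then obtain x y zs where "xs = x # y # zs" "length zs = n" by (auto simp: length_Suc_conv)
  moreover from this have "map ((!) xs) [2..<Suc (Suc n)] = zs"
    by (intro nth_equalityI) (auto simp del: upt_Suc)
  ultimately show "?g (map ((!) xs) (0 # [2..<Suc (Suc n)])) = f (hd xs) (tl (tl xs))"
    by (simp del: upt_Suc)
qed

lemma computable_vars [computable_intros]: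
  "1 < n \<Longrightarrow> computable n (\<lambda>xs. hd (tl xs))"
  "2 < n \<Longrightarrow> computable n (\<lambda>xs. hd (tl (tl xs)))"
  "3 < n \<Longrightarrow> computable n (\<lambda>xs. hd (tl (tl (tl xs))))"
  "4 < n \<Longrightarrow> computable n (\<lambda>xs. hd (tl (tl (tl (tl xs)))))"
  "5 < n \<Longrightarrow> computable n (\<lambda>xs. hd (tl (tl (tl (tl (tl xs))))))"
proof -
  have *: "computable n (\<lambda>xs. f (tl xs))" if "0 < n" "computable (n - 1) f" for n f
    using computable_tl[OF that(2)] that(1) by simp
  note 1 = *[OF _ computable_hd]
  note 2 = *[OF _ 1]
  note 3 = *[OF _ 2]
  note 4 = *[OF _ 3]
  note 5 = *[OF _ 4]
  show "1 < n \<Longrightarrow> computable n (\<lambda>xs. hd (tl xs))"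
    "2 < n \<Longrightarrow> computable n (\<lambda>xs. hd (tl (tl xs)))"
    "3 < n \<Longrightarrow> computable n (\<lambda>xs. hd (tl (tl (tl xs))))"
    "4 < n \<Longrightarrow> computable n (\<lambda>xs. hd (tl (tl (tl (tl xs)))))"
    "5 < n \<Longrightarrow> computable n (\<lambda>xs. hd (tl (tl (tl (tl (tl xs))))))"
    by (rule 1 2 3 4 5; simp)+
qed

lemma computable_comp:
  assumes "computable (length fs) g" "\<And>f. f \<in> set fs \<Longrightarrow> computable n f"
  shows "computable n (\<lambda>xs. g (map (\<lambda>f. f xs) fs))"
proof -
  obtain p where p: "\<And>xs. length xs = length fs \<Longrightarrow> evaluates p xs (g xs)"
    using assms(1) by (auto simp: computable_def)
  obtain q where q: "\<And>f xs. f \<in> set fs \<Longrightarrow> length xs = n \<Longrightarrow> evaluates (q f) xs (f xs)"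
    using assms(2) unfolding computable_def by metis
  have "evaluates (Comp p (map q fs)) xs (g (map (\<lambda>f. f xs) fs))" if "length xs = n" for xs
    using that by (intro evaluates.intros(4)[where ys = "map (\<lambda>f. f xs) fs"] p)
      (auto simp: list_all2_conv_all_nth intro!: q)
  then show ?thesis unfolding computable_def by blast
qed

lemma computable_comp1:
  "computable (Suc 0) (\<lambda>xs. g (hd xs)) \<Longrightarrow> computable n f \<Longrightarrow> computable n (\<lambda>xs. g (f xs))"
  using computable_comp[of "[f]" "\<lambda>xs. g (hd xs)" n] by simp

lemma computable_comp2:
  "computable (Suc (Suc 0)) (\<lambda>xs. g (hd xs) (hd (tl xs))) \<Longrightarrow> computable n f1 \<Longrightarrow> computable n f2 \<Longrightarrow>
    computable n (\<lambda>xs. g (f1 xs) (f2 xs))"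
proof -
  assume g: "computable (Suc (Suc 0)) (\<lambda>xs. g (hd xs) (hd (tl xs)))"
    and "computable n f1" "computable n f2"
  then have "computable n h" if "h \<in> set [f1, f2]" for h using that by auto
  from computable_comp[of "[f1, f2]" "\<lambda>xs. g (hd xs) (hd (tl xs))", OF _ this] g show ?thesis by simp
qed

lemma evaluates_projections:
  "length xs = n \<Longrightarrow> list_all2 (\<lambda>q y. evaluates q xs y) (map Proj [0..<n]) xs"
  by (auto simp: list_all2_conv_all_nth intro!: evaluates.intros(3))

lemma computable_Suc [computable_intros]: "computable n f \<Longrightarrow> computable n (\<lambda>xs. Suc (f xs))"
proof (rule computable_comp1[where g = Suc])
  have "evaluates Succ xs (Suc (hd xs))" if "length xs = Suc 0" for xs
    using that by (cases xs) (auto intro: evaluates.intros(2))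
  then show "computable (Suc 0) (\<lambda>xs. Suc (hd xs))" unfolding computable_def by blast
qed

lemma computable_const [computable_intros]: "computable n (\<lambda>_. c)"
proof (induction c)
  case 0
  then show ?case unfolding computable_def by (blast intro: evaluates.intros(1))
qed (rule computable_Suc)

lemma computable_rec [computable_intros]:
  assumes "computable n a" "computable (Suc (Suc n)) (\<lambda>ys. g (hd ys) (hd (tl ys)) (tl (tl ys)))"
    and "computable n b"
  shows "computable n (\<lambda>xs. rec_nat (a xs) (\<lambda>i r. g i r xs) (b xs))"
proof -
  obtain p where p: "\<And>xs. length xs = n \<Longrightarrow> evaluates p xs (a xs)"
    using assms(1) by (auto simp: computable_def)
  obtain q where q: "\<And>ys. length ys = Suc (Suc n) \<Longrightarrow>
      evaluates q ys (g (hd ys) (hd (tl ys)) (tl (tl ys)))"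
    using assms(2) unfolding computable_def by blast
  have q: "evaluates q (i # r # xs) (g i r xs)" if "length xs = n" for i r xs
    using q[of "i # r # xs"] that by simp
  obtain s where s: "\<And>xs. length xs = n \<Longrightarrow> evaluates s xs (b xs)"
    using assms(3) by (auto simp: computable_def)
  have rec: "evaluates (PrimRec p q) (i # xs) (rec_nat (a xs) (\<lambda>i r. g i r xs) i)"
    if "length xs = n" for i xs
    by (induction i) (auto intro: evaluates.intros p q that)
  have "evaluates (Comp (PrimRec p q) (s # map Proj [0..<n])) xs
      (rec_nat (a xs) (\<lambda>i r. g i r xs) (b xs))" if "length xs = n" for xs
  proof (rule evaluates.intros(4)[OF _ rec[OF that]])
    show "list_all2 (\<lambda>q y. evaluates q xs y) (s # map Proj [0..<n]) (b xs # xs)"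
      using s[OF that] evaluates_projections[OF that] by simp
  qed
  then show ?thesis unfolding computable_def by blast
qed

lemma computable_add [computable_intros]:
  assumes "computable n f" "computable n g" shows "computable n (\<lambda>xs. f xs + g xs)"
proof -
  have "computable n (\<lambda>xs. rec_nat (f xs) (\<lambda>i r. Suc r) (g xs))"
    by (intro computable_intros assms) simp
  moreover have "rec_nat a (\<lambda>i r. Suc r) b = a + b" for a b by (induction b) auto
  ultimately show ?thesis by simp
qed

lemma computable_mult [computable_intros]:
  assumes "computable n f" "computable n g" shows "computable n (\<lambda>xs. f xs * g xs)"
proof -
  have "computable (Suc (Suc 0)) (\<lambda>xs. rec_nat 0 (\<lambda>i r. r + hd xs) (hd (tl xs)))"
    by (intro computable_intros) simp_all
  moreover have "rec_nat 0 (\<lambda>i r. r + a) b = a * b" for a b :: nat by (induction b) auto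
  ultimately have "computable (Suc (Suc 0)) (\<lambda>xs. hd xs * hd (tl xs))" by simp
  from computable_comp2[OF this assms] show ?thesis .
qed

lemma computable_power [computable_intros]:
  assumes "computable n f" "computable n g" shows "computable n (\<lambda>xs. f xs ^ g xs)"
proof -
  have "computable (Suc (Suc 0)) (\<lambda>xs. rec_nat 1 (\<lambda>i r. r * hd xs) (hd (tl xs)))"
    by (intro computable_intros) simp_all
  moreover have "rec_nat 1 (\<lambda>i r. r * a) b = a ^ b" for a b :: nat by (induction b) (auto simp: mult.commute)
  ultimately have "computable (Suc (Suc 0)) (\<lambda>xs. hd xs ^ hd (tl xs))" by simp
  from computable_comp2[OF this assms] show ?thesis .
qed

lemma computable_diff [computable_intros]:
  assumes "computable n f" "computable n g" shows "computable n (\<lambda>xs. f xs - g xs)"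
proof -
  have pred: "computable n (\<lambda>xs. h xs - 1)" if "computable n h" for n h
  proof -
    have "computable n (\<lambda>xs. rec_nat 0 (\<lambda>i r. i) (h xs))"
      by (intro computable_intros that) simp
    moreover have "rec_nat 0 (\<lambda>i r. i) b = b - 1" for b by (cases b) auto
    ultimately show ?thesis by simp
  qed
  have "computable n (\<lambda>xs. rec_nat (f xs) (\<lambda>i r. r - 1) (g xs))"
    by (intro computable_intros assms pred) simp
  moreover have "rec_nat a (\<lambda>i r. r - 1) b = a - b" for a b by (induction b) auto
  ultimately show ?thesis by simp
qed

section \<open>Decidable predicates and bounded quantifiers\<close>

lemma decidable_const [computable_intros]: "decidable n (\<lambda>_. b)"
  unfolding decidable_def by (rule computable_const)

lemma decidable_not [computable_intros]:
  assumes "decidable n P" shows "decidable n (\<lambda>xs. \<not> P xs)"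
proof -
  have "computable n (\<lambda>xs. 1 - of_bool (P xs))"
    using assms unfolding decidable_def by (intro computable_intros)
  moreover have eq: "of_bool (\<not> p) = (1 - of_bool p :: nat)" for p by simp
  ultimately show ?thesis unfolding decidable_def eq by simp
qed

lemma decidable_conj [computable_intros]:
  assumes "decidable n P" "decidable n Q" shows "decidable n (\<lambda>xs. P xs \<and> Q xs)"
  using assms computable_mult unfolding decidable_def by (simp add: of_bool_conj)

lemma decidable_disj [computable_intros]:
  assumes "decidable n P" "decidable n Q" shows "decidable n (\<lambda>xs. P xs \<or> Q xs)"
  using decidable_not[OF decidable_conj[OF decidable_not[OF assms(1)] decidable_not[OF assms(2)]]]
  by simp

lemma decidable_imp [computable_intros]:
  assumes "decidable n P" "decidable n Q" shows "decidable n (\<lambda>xs. P xs \<longrightarrow> Q xs)"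
  unfolding imp_conv_disj by (intro decidable_disj decidable_not assms)

lemma decidable_le [computable_intros]:
  assumes "computable n f" "computable n g" shows "decidable n (\<lambda>xs. f xs \<le> g xs)"
proof -
  have "computable n (\<lambda>xs. 1 - (f xs - g xs))" by (intro computable_intros assms)
  moreover have "1 - (a - b) = of_bool (a \<le> b)" for a b :: nat by auto
  ultimately show ?thesis unfolding decidable_def by simp
qed

lemma decidable_less [computable_intros]:
  assumes "computable n f" "computable n g" shows "decidable n (\<lambda>xs. f xs < g xs)"
  using decidable_not[OF decidable_le[OF assms(2,1)]] by (simp add: not_le)

lemma decidable_eq [computable_intros]:
  assumes "computable n f" "computable n g" shows "decidable n (\<lambda>xs. f xs = g xs)"
  using decidable_conj[OF decidable_le[OF assms] decidable_le[OF assms(2,1)]]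
  by (simp flip: order_eq_iff)

lemma computable_if [computable_intros]:
  assumes "decidable n P" "computable n f" "computable n g"
  shows "computable n (\<lambda>xs. if P xs then f xs else g xs)"
proof -
  have "computable n (\<lambda>xs. of_bool (P xs) * f xs + of_bool (\<not> P xs) * g xs)"
    using assms(1) decidable_not[OF assms(1)] unfolding decidable_def
    by (intro computable_intros assms)
  then show ?thesis by (rule computable_cong) simp
qed

lemma decidable_all_le [computable_intros]:
  assumes "decidable (Suc n) (\<lambda>ys. P (hd ys) (tl ys))" "computable n b"
  shows "decidable n (\<lambda>xs. \<forall>i\<le>b xs. P i xs)"
proof -
  have "computable (Suc (Suc n)) (\<lambda>ys. of_bool (P (hd ys) (tl (tl ys))))"
    using assms(1) unfolding decidable_def by (rule computable_skip)
  then have "computable n (\<lambda>xs. rec_nat 1 (\<lambda>i r. r * of_bool (P i xs)) (Suc (b xs)))"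
    by (intro computable_intros assms(2)) simp_all
  moreover have "rec_nat 1 (\<lambda>i r. r * of_bool (Q i)) (Suc j) = (of_bool (\<forall>i\<le>j. Q i) :: nat)" for Q j
    by (induction j) (auto simp: le_Suc_eq)
  ultimately show ?thesis unfolding decidable_def by (rule computable_cong)
qed

lemma decidable_all_less [computable_intros]:
  assumes "decidable (Suc n) (\<lambda>ys. P (hd ys) (tl ys))" "computable n b"
  shows "decidable n (\<lambda>xs. \<forall>i<b xs. P i xs)"
proof -
  have "decidable n (\<lambda>xs. b xs = 0 \<or> (\<forall>i\<le>b xs - 1. P i xs))"
    by (intro computable_intros assms)
  moreover have "(b xs = 0 \<or> (\<forall>i\<le>b xs - 1. P i xs)) \<longleftrightarrow> (\<forall>i<b xs. P i xs)" for xs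
    by (cases "b xs") (auto simp: less_Suc_eq_le)
  ultimately show ?thesis by simp
qed

lemma decidable_ex_le [computable_intros]:
  assumes "decidable (Suc n) (\<lambda>ys. P (hd ys) (tl ys))" "computable n b"
  shows "decidable n (\<lambda>xs. \<exists>i\<le>b xs. P i xs)"
  using decidable_not[OF decidable_all_le[OF decidable_not[OF assms(1)] assms(2)]] by simp

text \<open>The recursion runs through all candidates up to the bound and keeps the last one
  satisfying \<open>P\<close>, which is the only one.\<close>

lemma computable_graph:
  assumes "decidable (Suc n) (\<lambda>ys. P (hd ys) (tl ys))" "computable n b"
    and "\<And>xs. length xs = n \<Longrightarrow> f xs \<le> b xs \<and> (\<forall>i. P i xs \<longleftrightarrow> i = f xs)"
  shows "computable n f"
proof -
  have "decidable (Suc (Suc n)) (\<lambda>ys. P (hd ys) (tl (tl ys)))"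
    using assms(1) unfolding decidable_def by (rule computable_skip)
  then have "computable n (\<lambda>xs. rec_nat 0 (\<lambda>i r. if P i xs then i else r) (Suc (b xs)))"
    by (intro computable_intros assms(2)) simp_all
  moreover have "rec_nat 0 (\<lambda>i r. if P i xs then i else r) (Suc (b xs)) = f xs" if "length xs = n" for xs
  proof -
    have "rec_nat 0 (\<lambda>i r. if i = c then i else r) j = (if c < j then c else 0)" for c j :: nat
      by (induction j) auto
    then show ?thesis using assms(3)[OF that] by (simp add: less_Suc_eq_le)
  qed
  ultimately show ?thesis by (rule computable_cong)
qed

text \<open>Unbounded minimisation. Nothing is claimed for inputs without a solution, on which the
  search may run forever.\<close>

lemma computable_search:
  assumes "decidable (Suc n) (\<lambda>ys. Q (hd ys) (tl ys))"
    and "computable (Suc n) (\<lambda>ys. g (hd ys) (tl ys))"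
  obtains p where "\<And>xs. length xs = n \<Longrightarrow> \<exists>z. Q z xs \<Longrightarrow> \<exists>z. Q z xs \<and> evaluates p xs (g z xs)"
proof -
  \<comment> \<open>\<open>Mu\<close> stops at the first value 0, so success must be coded by 0 and
    failure by a successor.\<close>
  have "computable (Suc n) (\<lambda>ys. 1 - of_bool (Q (hd ys) (tl ys)))"
    using assms(1) unfolding decidable_def by (intro computable_intros)
  then obtain q where q: "\<And>ys. length ys = Suc n \<Longrightarrow> evaluates q ys (1 - of_bool (Q (hd ys) (tl ys)))"
    unfolding computable_def by blast
  have q: "evaluates q (i # xs) (1 - of_bool (Q i xs))" if "length xs = n" for i xs
    using q[of "i # xs"] that by simp
  obtain s where s: "\<And>ys. length ys = Suc n \<Longrightarrow> evaluates s ys (g (hd ys) (tl ys))"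
    using assms(2) unfolding computable_def by blast
  have s: "evaluates s (i # xs) (g i xs)" if "length xs = n" for i xs
    using s[of "i # xs"] that by simp
  show thesis
  proof (rule that)
    fix xs assume xs: "length xs = n" and ex: "\<exists>z. Q z xs"
    define z where "z = (LEAST z. Q z xs)"
    have z: "Q z xs" "\<And>i. i < z \<Longrightarrow> \<not> Q i xs"
      using ex LeastI_ex not_less_Least unfolding z_def by metis+
    have "evaluates (Mu q) xs z"
    proof (rule evaluates.intros(7))
      show "evaluates q (z # xs) 0" using q[OF xs, of z] z(1) by simp
      have "evaluates q (i # xs) (Suc 0)" if "i < z" for i
        using q[OF xs, of i] z(2)[OF that] by simp
      then show "\<forall>i<z. \<exists>y. evaluates q (i # xs) (Suc y)" by blast
    qed
    then have "list_all2 (\<lambda>q y. evaluates q xs y) (Mu q # map Proj [0..<n]) (z # xs)"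
      using evaluates_projections[OF xs] by simp
    then have "evaluates (Comp s (Mu q # map Proj [0..<n])) xs (g z xs)"
      using s[OF xs] by (rule evaluates.intros(4))
    then show "\<exists>z. Q z xs \<and> evaluates (Comp s (Mu q # map Proj [0..<n])) xs (g z xs)"
      using z(1) by blast
  qed
qed

section \<open>Computing with words\<close>

lemma computable_let:
  assumes "computable (Suc n) (\<lambda>ys. g (hd ys) (tl ys))" "computable n h"
  shows "computable n (\<lambda>xs. g (h xs) xs)"
proof -
  obtain p where p: "\<And>ys. length ys = Suc n \<Longrightarrow> evaluates p ys (g (hd ys) (tl ys))"
    using assms(1) unfolding computable_def by blast
  obtain q where q: "\<And>xs. length xs = n \<Longrightarrow> evaluates q xs (h xs)"
    using assms(2) unfolding computable_def by blast
  have "evaluates (Comp p (q # map Proj [0..<n])) xs (g (h xs) xs)" if "length xs = n" for xs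
    using p[of "h xs # xs"] q[OF that] evaluates_projections[OF that] that
    by (intro evaluates.intros(4)[where ys = "h xs # xs"]) simp_all
  then show ?thesis unfolding computable_def by blast
qed

lemma computable_funpow:
  assumes "\<And>n f. computable n f \<Longrightarrow> computable n (\<lambda>xs. h (f xs))" "computable n f" "computable n g"
  shows "computable n (\<lambda>xs. (h ^^ g xs) (f xs))"
proof -
  have "computable n (\<lambda>xs. rec_nat (f xs) (\<lambda>i r. h r) (g xs))"
    by (intro computable_intros assms) simp
  moreover have "rec_nat a (\<lambda>i r. h r) b = (h ^^ b) a" for a b by (induction b) auto
  ultimately show ?thesis by simp
qed

lemma computable_prod_encode [computable_intros]:
  assumes "computable n f" "computable n g" shows "computable n (\<lambda>xs. prod_encode (f xs, g xs))"
proof -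
  have "computable n (\<lambda>xs. rec_nat 0 (\<lambda>i r. r + Suc i) (f xs + g xs) + f xs)"
    by (intro computable_intros assms) simp_all
  moreover have "rec_nat 0 (\<lambda>i r. r + Suc i) j = triangle j" for j by (induction j) auto
  ultimately show ?thesis by (simp add: prod_encode_def)
qed

text \<open>Both components of a pair are at most its code, so each projection has a graph that a
  bounded search decides.\<close>

lemma computable_prod_decode [computable_intros]:
  assumes "computable n f"
  shows "computable n (\<lambda>xs. fst (prod_decode (f xs)))" "computable n (\<lambda>xs. snd (prod_decode (f xs)))"
proof -
  have eq: "(\<exists>j\<le>c. prod_encode (i, j) = c) \<longleftrightarrow> i = fst (prod_decode c)"
    "(\<exists>j\<le>c. prod_encode (j, i) = c) \<longleftrightarrow> i = snd (prod_decode c)" for i c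
    by (metis fst_conv le_prod_encode_2 prod.collapse prod_decode_inverse prod_encode_inverse)
      (metis snd_conv le_prod_encode_1 prod.collapse prod_decode_inverse prod_encode_inverse)
  have le: "fst (prod_decode c) \<le> c" "snd (prod_decode c) \<le> c" for c
    by (metis le_prod_encode_1 prod.collapse prod_decode_inverse)
      (metis le_prod_encode_2 prod.collapse prod_decode_inverse)
  have "computable (Suc 0) (\<lambda>xs. fst (prod_decode (hd xs)))"
  proof (rule computable_graph)
    show "decidable (Suc (Suc 0)) (\<lambda>ys. \<exists>j\<le>hd (tl ys). prod_encode (hd ys, j) = hd (tl ys))"
      by (intro computable_intros) simp_all
    show "computable (Suc 0) (\<lambda>xs. hd xs)" by (intro computable_intros) simp
  qed (use eq le in simp)
  then show "computable n (\<lambda>xs. fst (prod_decode (f xs)))" using assms by (rule computable_comp1)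
  have "computable (Suc 0) (\<lambda>xs. snd (prod_decode (hd xs)))"
  proof (rule computable_graph)
    show "decidable (Suc (Suc 0)) (\<lambda>ys. \<exists>j\<le>hd (tl ys). prod_encode (j, hd ys) = hd (tl ys))"
      by (intro computable_intros) simp_all
    show "computable (Suc 0) (\<lambda>xs. hd xs)" by (intro computable_intros) simp
  qed (use eq le in simp)
  then show "computable n (\<lambda>xs. snd (prod_decode (f xs)))" using assms by (rule computable_comp1)
qed

lemma computable_half [computable_intros]:
  assumes "computable n f" shows "computable n (\<lambda>xs. f xs div 2)"
proof -
  have "computable (Suc 0) (\<lambda>xs. hd xs div 2)"
  proof (rule computable_graph)
    show "decidable (Suc (Suc 0)) (\<lambda>ys. 2 * hd ys \<le> hd (tl ys) \<and> hd (tl ys) \<le> 2 * hd ys + 1)"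
      by (intro computable_intros) simp_all
    show "computable (Suc 0) (\<lambda>xs. hd xs)" by (intro computable_intros) simp
    show "hd xs div 2 \<le> hd xs \<and> (\<forall>i. 2 * i \<le> hd xs \<and> hd xs \<le> 2 * i + 1 \<longleftrightarrow> i = hd xs div 2)"
      for xs :: "nat list" by presburger
  qed
  then show ?thesis using assms by (rule computable_comp1)
qed

definition code_hd :: "nat \<Rightarrow> nat" where
  "code_hd c = fst (prod_decode (c - 1))"

text \<open>Subtracting 1 undoes the successor in the code of a nonempty list. Since
  \<open>prod_decode 0 = (0, 0)\<close>, the empty list, coded by 0, is its own tail.\<close>

definition code_tl :: "nat \<Rightarrow> nat" where
  "code_tl c = snd (prod_decode (c - 1))"

lemma code_hd_Suc [simp]: "code_hd (Suc (prod_encode (x, c))) = x"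
  by (simp add: code_hd_def)

lemma code_tl_list_encode: "code_tl (list_encode xs) = list_encode (tl xs)"
proof (cases xs)
  case Nil
  have "prod_decode 0 = (0, 0)"
    using prod_encode_inverse[of "(0, 0)"] by (simp add: prod_encode_def)
  then show ?thesis using Nil by (simp add: code_tl_def)
qed (simp add: code_tl_def)

lemma funpow_code_tl: "(code_tl ^^ i) (list_encode xs) = list_encode (drop i xs)"
  by (induction i arbitrary: xs) (simp_all add: code_tl_list_encode drop_Suc tl_drop)

lemma list_encode_eq_0_iff [simp]: "list_encode xs = 0 \<longleftrightarrow> xs = []"
  by (cases xs) auto

lemma computable_code_hd_tl [computable_intros]:
  assumes "computable n f"
  shows "computable n (\<lambda>xs. code_hd (f xs))" "computable n (\<lambda>xs. code_tl (f xs))"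
  unfolding code_hd_def code_tl_def by (intro computable_intros assms)+

lemma length_le_list_encode: "length xs \<le> list_encode xs"
proof (induction xs)
  case (Cons x xs)
  then show ?case using le_prod_encode_2[of "list_encode xs" x] by simp
qed simp

text \<open>A right fold consumes the last entry first, so stage \<open>j\<close> looks up an entry
  by repeated tails. The code bounds the length of its list and can serve as the number of
  stages.\<close>

lemma computable_foldr:
  assumes c: "computable n c" and a: "computable n a"
    and g: "computable (Suc (Suc n)) (\<lambda>ys. g (hd ys) (hd (tl ys)) (tl (tl ys)))"
  shows "computable n (\<lambda>xs. foldr (\<lambda>x r. g x r xs) (list_decode (c xs)) (a xs))"
proof -
  \<comment> \<open>Early stages lie beyond the end of the list, where \<open>d\<close> is 0 and the
    accumulator is left unchanged.\<close>
  define d where "d j c = (code_tl ^^ (c - 1 - j)) c" for j c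
  have d: "computable (Suc (Suc n)) (\<lambda>ys. d (hd ys) (c (tl (tl ys))))"
    unfolding d_def
    by (intro computable_funpow computable_intros computable_tl c) simp_all
  have "computable (Suc (Suc n)) (\<lambda>ys. g (code_hd (d (hd ys) (c (tl (tl ys))))) (hd (tl ys)) (tl (tl ys)))"
    by (rule computable_let[OF computable_skip[where f = "\<lambda>x zs. g x (hd zs) (tl zs)", OF g]])
      (intro computable_intros d)
  then have "computable n (\<lambda>xs. rec_nat (a xs)
      (\<lambda>j r. if d j (c xs) = 0 then r else g (code_hd (d j (c xs))) r xs) (c xs))"
    by (intro computable_intros a c d) simp_all
  then show ?thesis
  proof (rule computable_cong)
    fix xs :: "nat list"
    define ns where "ns = list_decode (c xs)"
    have cx: "c xs = list_encode ns" by (simp add: ns_def)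
    have dj: "d j (c xs) = list_encode (drop (c xs - 1 - j) ns)" for j
      unfolding d_def using funpow_code_tl cx by simp
    have "rec_nat (a xs) (\<lambda>j r. if d j (c xs) = 0 then r else g (code_hd (d j (c xs))) r xs) j
        = foldr (\<lambda>x r. g x r xs) (drop (c xs - j) ns) (a xs)" if "j \<le> c xs" for j
      using that
    proof (induction j)
      case 0
      then show ?case using length_le_list_encode[of ns] cx by simp
    next
      case (Suc j)
      have "c xs - Suc j = c xs - 1 - j" by simp
      moreover have "c xs - j = Suc (c xs - 1 - j)" using Suc.prems by simp
      ultimately show ?case
        using Suc dj[of j]
        by (cases "drop (c xs - 1 - j) ns") (auto simp: drop_Suc tl_drop[symmetric])
    qed
    from this[of "c xs"] show "rec_nat (a xs) (\<lambda>j r. if d j (c xs) = 0 then r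
        else g (code_hd (d j (c xs))) r xs) (c xs) = foldr (\<lambda>x r. g x r xs) (list_decode (c xs)) (a xs)"
      by (simp add: ns_def)
  qed
qed

lemma computable_list_encode: "computable n list_encode"
proof (induction n)
  case 0
  show ?case by (rule computable_cong[OF computable_const[of _ 0]]) simp
next
  case (Suc n)
  have "computable (Suc n) (\<lambda>xs. Suc (prod_encode (hd xs, list_encode (tl xs))))"
    by (intro computable_intros computable_tl Suc) simp
  then show ?case
  proof (rule computable_cong)
    show "Suc (prod_encode (hd xs, list_encode (tl xs))) = list_encode xs" if "length xs = Suc n" for xs
      using that by (cases xs) auto
  qed
qed

definition letter_code :: "letter \<Rightarrow> nat" where
  "letter_code x = 2 * fst x + of_bool (snd x)"

definition letter_decode :: "nat \<Rightarrow> letter" where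
  "letter_decode n = (n div 2, odd n)"

text \<open>Each natural number codes exactly one word, so searching through numbers is searching
  through words.\<close>

definition word_decode :: "nat \<Rightarrow> word" where
  "word_decode c = map letter_decode (list_decode c)"

lemma letter_code_inverse [simp]: "letter_decode (letter_code x) = x"
  by (cases x) (auto simp: letter_code_def letter_decode_def)

lemma letter_decode_inverse [simp]: "letter_code (letter_decode n) = n"
  by (simp add: letter_code_def letter_decode_def)

lemma word_code_eq: "word_code w = list_encode (map letter_code w)"
proof -
  have "(\<lambda>(i, b). 2 * i + of_bool b) = letter_code" by (auto simp: letter_code_def)
  then show ?thesis by (simp add: word_code_def)
qed

lemma word_code_inverse [simp]: "word_decode (word_code w) = w"
  by (simp add: word_decode_def word_code_eq o_def)

lemma word_decode_inverse [simp]: "word_code (word_decode c) = c"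
  by (simp add: word_decode_def word_code_eq o_def)

lemma word_code_inject [simp]: "word_code u = word_code v \<longleftrightarrow> u = v"
  by (metis word_code_inverse)

lemma letter_code_inject [simp]: "letter_code x = letter_code y \<longleftrightarrow> x = y"
  by (metis letter_code_inverse)

lemma word_code_Nil: "word_code [] = 0"
  and word_code_Cons: "word_code (x # w) = Suc (prod_encode (letter_code x, word_code w))"
  by (simp_all add: word_code_eq)

definition computable_letter :: "nat \<Rightarrow> (nat list \<Rightarrow> letter) \<Rightarrow> bool" where
  "computable_letter n L \<longleftrightarrow> computable n (\<lambda>xs. letter_code (L xs))"

definition computable_word :: "nat \<Rightarrow> (nat list \<Rightarrow> word) \<Rightarrow> bool" where
  "computable_word n W \<longleftrightarrow> computable n (\<lambda>xs. word_code (W xs))"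

lemma computable_letter_decode [computable_intros]:
  "computable n f \<Longrightarrow> computable_letter n (\<lambda>xs. letter_decode (f xs))"
  by (simp add: computable_letter_def)

lemma computable_word_decode [computable_intros]:
  "computable n f \<Longrightarrow> computable_word n (\<lambda>xs. word_decode (f xs))"
  by (simp add: computable_word_def)

lemma computable_fst_letter [computable_intros]:
  assumes "computable_letter n L" shows "computable n (\<lambda>xs. fst (L xs))"
proof -
  have "computable n (\<lambda>xs. letter_code (L xs) div 2)"
    using assms unfolding computable_letter_def by (intro computable_intros)
  then show ?thesis by (simp add: letter_code_def)
qed

lemma decidable_snd_letter [computable_intros]:
  assumes "computable_letter n L" shows "decidable n (\<lambda>xs. snd (L xs))"
proof -
  have "decidable n (\<lambda>xs. letter_code (L xs) = 2 * fst (L xs) + 1)"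
    by (intro computable_intros assms assms[unfolded computable_letter_def])
  moreover have "letter_code x = 2 * fst x + 1 \<longleftrightarrow> snd x" for x by (simp add: letter_code_def)
  ultimately show ?thesis by simp
qed

lemma decidable_eq_letter [computable_intros]:
  assumes "computable_letter n L" "computable_letter n M" shows "decidable n (\<lambda>xs. L xs = M xs)"
  using decidable_eq[OF assms[unfolded computable_letter_def]] by simp

lemma decidable_eq_word [computable_intros]:
  assumes "computable_word n U" "computable_word n V" shows "decidable n (\<lambda>xs. U xs = V xs)"
  using decidable_eq[OF assms[unfolded computable_word_def]] by simp

lemma computable_inv_letter [computable_intros]:
  assumes "computable_letter n L" shows "computable_letter n (\<lambda>xs. inv_letter (L xs))"
proof -
  have "computable n (\<lambda>xs. if snd (L xs) then 2 * fst (L xs) else 2 * fst (L xs) + 1)"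
    by (intro computable_intros assms)
  then show ?thesis unfolding computable_letter_def
    by (rule computable_cong) (simp add: letter_code_def inv_letter_def)
qed

lemma computable_Nil [computable_intros]: "computable_word n (\<lambda>_. [])"
  unfolding computable_word_def by (rule computable_const)

lemma computable_Cons [computable_intros]:
  "computable_letter n L \<Longrightarrow> computable_word n W \<Longrightarrow> computable_word n (\<lambda>xs. L xs # W xs)"
  unfolding computable_letter_def computable_word_def word_code_Cons by (intro computable_intros)

lemma computable_word_if [computable_intros]:
  assumes "decidable n P" "computable_word n U" "computable_word n V"
  shows "computable_word n (\<lambda>xs. if P xs then U xs else V xs)"
  using computable_if[OF assms(1) assms(2,3)[unfolded computable_word_def]]
  unfolding computable_word_def by (simp add: if_distrib)

lemma computable_tl_word [computable_intros]:
  assumes "computable_word n W" shows "computable_word n (\<lambda>xs. tl (W xs))"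
proof -
  have "computable n (\<lambda>xs. code_tl (word_code (W xs)))"
    using assms unfolding computable_word_def by (intro computable_intros)
  then show ?thesis
    by (simp add: computable_word_def word_code_eq code_tl_list_encode map_tl)
qed

lemma foldr_letter_codes:
  "foldr (\<lambda>x r. h (letter_decode x) r) (list_decode (word_code w)) a = foldr h w a"
  by (induction w) (simp_all add: word_code_eq)

lemma computable_foldr_word_nat [computable_intros]:
  assumes "computable_word n W" "computable n a"
    and "computable (Suc (Suc n)) (\<lambda>ys. g (letter_decode (hd ys)) (hd (tl ys)) (tl (tl ys)))"
  shows "computable n (\<lambda>xs. foldr (\<lambda>x r. g x r xs) (W xs) (a xs))"
proof -
  have "computable n (\<lambda>xs. foldr (\<lambda>x r. g (letter_decode x) r xs) (list_decode (word_code (W xs))) (a xs))"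
    using assms unfolding computable_word_def by (intro computable_foldr)
  then show ?thesis by (simp only: foldr_letter_codes[where h = "\<lambda>x r. g x r xs" for xs])
qed

lemma computable_foldr_word [computable_intros]:
  assumes W: "computable_word n W" and A: "computable_word n A"
    and "computable_word (Suc (Suc n))
      (\<lambda>ys. g (letter_decode (hd ys)) (word_decode (hd (tl ys))) (tl (tl ys)))"
  shows "computable_word n (\<lambda>xs. foldr (\<lambda>x r. g x r xs) (W xs) (A xs))"
proof -
  have *: "computable n (\<lambda>xs. foldr (\<lambda>x r. word_code (g x (word_decode r) xs)) (W xs) (word_code (A xs)))"
    using assms unfolding computable_word_def
    by (intro computable_foldr_word_nat) (simp_all add: computable_word_def)
  have "foldr (\<lambda>x r. word_code (h x (word_decode r))) w (word_code a) = word_code (foldr h w a)"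
    for h :: "letter \<Rightarrow> word \<Rightarrow> word" and w a
    by (induction w) simp_all
  note eq = this
  show ?thesis
    using * unfolding computable_word_def by (simp only: eq[where h = "\<lambda>x r. g x r xs" for xs])
qed

lemma decidable_hd_eq:
  assumes "computable_word n W" "computable_letter n L"
  shows "decidable n (\<lambda>xs. W xs \<noteq> [] \<and> hd (W xs) = L xs)"
proof -
  have "decidable n (\<lambda>xs. W xs \<noteq> [] \<and> code_hd (word_code (W xs)) = letter_code (L xs))"
    by (intro computable_intros assms assms[unfolded computable_word_def computable_letter_def])
  moreover have "W xs \<noteq> [] \<Longrightarrow> code_hd (word_code (W xs)) = letter_code (hd (W xs))" for xs
    by (cases "W xs") (simp_all add: word_code_eq)
  ultimately show ?thesis by (simp cong: conj_cong)
qed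

lemma computable_cancel_cons [computable_intros]:
  assumes "computable_letter n L" "computable_word n W"
  shows "computable_word n (\<lambda>xs. cancel_cons (L xs) (W xs))"
proof -
  have "computable_word n (\<lambda>xs. if W xs \<noteq> [] \<and> hd (W xs) = inv_letter (L xs) then tl (W xs) else L xs # W xs)"
    by (intro computable_word_if decidable_hd_eq computable_intros assms)
  moreover have eq: "cancel_cons x w = (if w \<noteq> [] \<and> hd w = inv_letter x then tl w else x # w)" for x w
    by (cases w) simp_all
  ultimately show ?thesis unfolding eq by simp
qed

lemma computable_free_reduce [computable_intros]:
  "computable_word n W \<Longrightarrow> computable_word n (\<lambda>xs. free_reduce (W xs))"
  unfolding free_reduce_def by (intro computable_intros) simp_all

lemma computable_append [computable_intros]:
  assumes "computable_word n U" "computable_word n V" shows "computable_word n (\<lambda>xs. U xs @ V xs)"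
proof -
  have "computable_word n (\<lambda>xs. foldr (\<lambda>x r. x # r) (U xs) (V xs))"
    by (intro computable_intros assms) simp_all
  moreover have "foldr (\<lambda>x r. x # r) u v = u @ v" for u v :: word by (induction u) auto
  ultimately show ?thesis by simp
qed

lemma computable_winv [computable_intros]:
  assumes "computable_word n W" shows "computable_word n (\<lambda>xs. winv (W xs))"
proof -
  have "computable_word n (\<lambda>xs. foldr (\<lambda>x r. r @ [inv_letter x]) (W xs) [])"
    by (intro computable_intros assms) simp_all
  moreover have "foldr (\<lambda>x r. r @ [inv_letter x]) w [] = winv w" for w by (induction w) auto
  ultimately show ?thesis by simp
qed

lemma computable_length [computable_intros]:
  assumes "computable_word n W" shows "computable n (\<lambda>xs. length (W xs))"
proof -
  have "computable n (\<lambda>xs. foldr (\<lambda>x r. Suc r) (W xs) 0)"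
    by (intro computable_intros assms) simp_all
  moreover have "foldr (\<lambda>x r. Suc r) w 0 = length w" for w :: word by (induction w) auto
  ultimately show ?thesis by simp
qed

lemma computable_cyc_len [computable_intros]:
  "computable_word n W \<Longrightarrow> computable n (\<lambda>xs. cyc_len (W xs))"
  unfolding cyc_len_def rlen_def by (intro computable_intros)

lemma decidable_word_over [computable_intros]:
  assumes "computable_word n W" shows "decidable n (\<lambda>xs. word_over k (W xs))"
proof -
  have "computable n (\<lambda>xs. foldr (\<lambda>x r. if fst x < k then r else 0) (W xs) 1)"
    by (intro computable_intros assms) simp_all
  moreover have "foldr (\<lambda>x r. if fst x < k then r else 0) w 1 = (of_bool (word_over k w) :: nat)" for w
    by (induction w) auto
  ultimately show ?thesis unfolding decidable_def by simp
qed

text \<open>The \<open>k\<close> input words are packed into a single number, which gives all later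
  predicates an arity independent of \<open>k\<close>.\<close>

definition decode_image :: "nat \<Rightarrow> nat \<Rightarrow> word" where
  "decode_image c i = word_decode (code_hd ((code_tl ^^ i) c))"

lemma decode_image_list_encode:
  assumes "i < k" shows "decode_image (list_encode (map (\<lambda>i. word_code (g i)) [0..<k])) i = g i"
  using assms unfolding decode_image_def funpow_code_tl
  by (subst Cons_nth_drop_Suc[symmetric]) simp_all

lemma computable_decode_image [computable_intros]:
  "computable n c \<Longrightarrow> computable n f \<Longrightarrow> computable_word n (\<lambda>xs. decode_image (c xs) (f xs))"
  unfolding decode_image_def by (intro computable_intros computable_funpow)

lemma computable_subst [computable_intros]:
  assumes c: "computable n c" and W: "computable_word n W"
  shows "computable_word n (\<lambda>xs. subst (decode_image (c xs)) (W xs))"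
proof -
  have "computable_word n (\<lambda>xs. foldr (\<lambda>x r. (if snd x then winv (decode_image (c xs) (fst x))
      else decode_image (c xs) (fst x)) @ r) (W xs) [])"
    by (intro computable_intros computable_tl[OF computable_tl[OF c]] W) simp_all
  moreover have "foldr (\<lambda>x r. (if snd x then winv (g (fst x)) else g (fst x)) @ r) w [] = subst g w" for g w
    by (induction w) (auto simp: letter_image_def)
  ultimately show ?thesis by simp
qed

section \<open>Computing the endpoints\<close>

text \<open>Letter codes over \<open>k\<close> basis elements are below \<open>2 * k\<close> and
  pairing is monotone, so this value bounds the codes of all words of length at most
  \<open>n\<close>. It turns a length bound into a bounded quantifier over codes.\<close>

primrec code_bound :: "nat \<Rightarrow> nat \<Rightarrow> nat" where
  "code_bound k 0 = 0"
| "code_bound k (Suc n) = Suc (prod_encode (2 * k, code_bound k n))"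

lemma prod_encode_mono:
  assumes "a \<le> a'" "b \<le> b'" shows "prod_encode (a, b) \<le> prod_encode (a', b')"
proof -
  have "triangle (a + b) \<le> triangle (a' + b')"
    using assms unfolding triangle_def by (intro div_le_mono mult_le_mono) auto
  then show ?thesis using assms by (simp add: prod_encode_def)
qed

lemma word_code_le_code_bound:
  "word_over k w \<Longrightarrow> length w \<le> n \<Longrightarrow> word_code w \<le> code_bound k n"
proof (induction w arbitrary: n)
  case (Cons x w)
  then obtain n' where "n = Suc n'" by (cases n) auto
  moreover have "letter_code x \<le> 2 * k" using Cons.prems by (simp add: letter_code_def)
  ultimately show ?case
    using Cons by (simp add: word_code_Cons prod_encode_mono)
qed (simp add: word_code_Nil)

lemma computable_code_bound [computable_intros]:
  assumes "computable n f" shows "computable n (\<lambda>xs. code_bound k (f xs))"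
proof -
  have "computable n (\<lambda>xs. rec_nat 0 (\<lambda>i r. Suc (prod_encode (2 * k, r))) (f xs))"
    by (intro computable_intros assms) simp_all
  moreover have "rec_nat 0 (\<lambda>i r. Suc (prod_encode (2 * k, r))) b = code_bound k b" for b
    by (induction b) simp_all
  ultimately show ?thesis by simp
qed

text \<open>Ratios are compared by cross multiplication, within the natural numbers. The codes below
  the bound may include longer words, which only makes the condition stronger.\<close>

definition extremal_words :: "nat \<Rightarrow> nat \<Rightarrow> (nat \<Rightarrow> word) \<Rightarrow> word \<Rightarrow> word \<Rightarrow> bool" where
  "extremal_words k N g wa wb \<longleftrightarrow>
     word_over k wa \<and> cyc_len wa \<noteq> 0 \<and> word_over k wb \<and> cyc_len wb \<noteq> 0 \<and>
     (\<forall>c\<le>code_bound k N. word_over k (word_decode c) \<and> cyc_len (word_decode c) \<noteq> 0 \<longrightarrow>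
       cyc_len (subst g wa) * cyc_len (word_decode c) \<le> cyc_len (subst g (word_decode c)) * cyc_len wa \<and>
       cyc_len (subst g (word_decode c)) * cyc_len wb \<le> cyc_len (subst g wb) * cyc_len (word_decode c))"

text \<open>Bounding the code of a preimage instead of its length keeps the quantifier bounded; the
  length is at most the code.\<close>

definition code_certificate :: "nat \<Rightarrow> (nat \<Rightarrow> word) \<Rightarrow> nat \<Rightarrow> bool" where
  "code_certificate k g m \<longleftrightarrow> (\<forall>i<k. length (g i) \<le> m \<and>
     (\<exists>c\<le>m. word_over k (word_decode c) \<and> free_reduce (subst g (word_decode c)) = gen i))"

lemma length_word_decode_le: "length (word_decode c) \<le> c"
  using length_le_list_encode[of "list_decode c"] by (simp add: word_decode_def)

lemma code_certificate_bound:
  "code_certificate k g m \<Longrightarrow> bound_certificate k g m"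
  unfolding code_certificate_def bound_certificate_def
  by (meson length_word_decode_le le_trans)

lemma ex_code_certificate:
  assumes "\<phi> \<in> auto (free_grp k)"
  shows "\<exists>m. code_certificate k (\<lambda>i. \<phi> (gen i)) m"
proof -
  let ?g = "\<lambda>i. \<phi> (gen i)"
  have "\<exists>u. word_over k u \<and> free_reduce (subst ?g u) = gen i" if "i < k" for i
    by (rule auto_generator_preimage[OF assms that]) blast
  then obtain U where U: "\<And>i. i < k \<Longrightarrow> word_over k (U i) \<and> free_reduce (subst ?g (U i)) = gen i"
    by metis
  define m where "m = (\<Sum>i<k. length (?g i) + word_code (U i))"
  have "length (?g i) + word_code (U i) \<le> m" if "i < k" for i
    unfolding m_def using that by (intro member_le_sum) auto
  then have "length (?g i) \<le> m \<and> word_code (U i) \<le> m" if "i < k" for i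
    using that by fastforce
  then have "code_certificate k ?g m"
    unfolding code_certificate_def using U word_code_inverse[of "U _"] by fastforce
  then show ?thesis ..
qed

lemma (in bilipschitz) ex_ratio_extrema:
  assumes "finite W" "W \<noteq> {}"
  obtains wa wb where "wa \<in> W" "wb \<in> W" "\<And>w. w \<in> W \<Longrightarrow> ratio wa \<le> ratio w \<and> ratio w \<le> ratio wb"
proof -
  have "finite (ratio ` W)" "ratio ` W \<noteq> {}" using assms by auto
  then have "Min (ratio ` W) \<in> ratio ` W" "Max (ratio ` W) \<in> ratio ` W"
    by (rule Min_in Max_in)+
  then obtain wa wb where "wa \<in> W" "Min (ratio ` W) = ratio wa" "wb \<in> W" "Max (ratio ` W) = ratio wb"
    by auto
  then show thesis
    using that[of wa wb] \<open>finite (ratio ` W)\<close> by (metis Max_ge Min_le imageI)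
qed

lemma ratio_cross_mult:
  fixes a b c d :: nat
  assumes "b \<noteq> 0" "d \<noteq> 0"
  shows "(of_nat a / of_nat b :: rat) \<le> of_nat c / of_nat d \<longleftrightarrow> a * d \<le> c * b"
proof -
  have "(of_nat a / of_nat b :: rat) \<le> of_nat c / of_nat d \<longleftrightarrow>
      (of_nat (a * d) :: rat) \<le> of_nat (c * b)"
    using assms by (simp add: field_simps)
  then show ?thesis by (simp only: of_nat_le_iff)
qed

lemma ex_extremal_words:
  assumes "bilipschitz k m (subst g)" "0 < k"
  shows "\<exists>wa wb. extremal_words k N g wa wb"
proof -
  interpret bilipschitz k m "subst g" by (rule assms(1))
  \<comment> \<open>\<open>Suc N\<close> instead of \<open>N\<close> makes room for the one-letter
    word \<open>gen 0\<close>, so that \<open>W\<close> is nonempty even for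
    \<open>N = 0\<close>.\<close>
  define W where "W = {w. word_over k w \<and> cyc_len w \<noteq> 0 \<and> word_code w \<le> code_bound k (Suc N)}"
  have "W \<subseteq> word_decode ` {..code_bound k (Suc N)}"
  proof
    fix w assume "w \<in> W"
    then have "word_decode (word_code w) \<in> word_decode ` {..code_bound k (Suc N)}"
      unfolding W_def by blast
    then show "w \<in> word_decode ` {..code_bound k (Suc N)}" by simp
  qed
  then have "finite W" by (rule finite_subset) simp
  moreover have "gen 0 \<in> W"
  proof -
    have "cyclically_reduced (gen 0)"
      by (simp add: gen_def cyclically_reduced_def reduced_def)
    then have "cyc_len (gen 0) \<noteq> 0" by (simp add: cyc_len_cyclic gen_def)
    moreover have over: "word_over k (gen 0)" using assms(2) by (simp add: gen_def)
    ultimately show ?thesis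
      using word_code_le_code_bound[OF over, of "Suc N"] by (simp add: W_def gen_def del: code_bound.simps)
  qed
  ultimately obtain wa wb where W: "wa \<in> W" "wb \<in> W"
    "\<And>w. w \<in> W \<Longrightarrow> ratio wa \<le> ratio w \<and> ratio w \<le> ratio wb"
    using ex_ratio_extrema[of W] by blast
  have mono: "code_bound k N \<le> code_bound k (Suc N)"
    using le_prod_encode_2[of "code_bound k N" "2 * k"] by simp
  have "extremal_words k N g wa wb"
    unfolding extremal_words_def
  proof (intro conjI allI impI; (elim conjE)?)
    show "word_over k wa" "cyc_len wa \<noteq> 0" "word_over k wb" "cyc_len wb \<noteq> 0"
      using W(1,2) by (simp_all add: W_def)
    fix c assume c: "c \<le> code_bound k N" "word_over k (word_decode c)" "cyc_len (word_decode c) \<noteq> 0"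
    then have "word_decode c \<in> W" using mono by (simp add: W_def del: code_bound.simps)
    then show "cyc_len (subst g wa) * cyc_len (word_decode c) \<le> cyc_len (subst g (word_decode c)) * cyc_len wa"
      "cyc_len (subst g (word_decode c)) * cyc_len wb \<le> cyc_len (subst g wb) * cyc_len (word_decode c)"
      using W(3)[of "word_decode c"] W(1,2) c(3)
      by (simp_all add: ratio_def ratio_cross_mult W_def)
  qed
  then show ?thesis by blast
qed

lemma subst_cong:
  "(\<And>i. i < k \<Longrightarrow> g i = h i) \<Longrightarrow> word_over k w \<Longrightarrow> subst g w = subst h w"
  by (induction w) (auto simp: letter_image_def)

lemma code_certificate_cong:
  assumes "\<And>i. i < k \<Longrightarrow> g i = h i"
  shows "code_certificate k g m \<longleftrightarrow> code_certificate k h m"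
  using assms subst_cong[of k g h] unfolding code_certificate_def by (metis (no_types, lifting))

lemma extremal_words_cong:
  assumes "\<And>i. i < k \<Longrightarrow> g i = h i"
  shows "extremal_words k N g wa wb \<longleftrightarrow> extremal_words k N h wa wb"
  using subst_cong[of k g h, OF assms] unfolding extremal_words_def by (auto; metis)

text \<open>Correctness for an arbitrary valid triple: neither \<open>m\<close> nor the extremal
  words need be optimal or canonical, so the output of any successful search is right.\<close>

lemma distortion_spectrum_interval:
  assumes "2 \<le> k" and \<phi>: "\<phi> \<in> auto (free_grp k)"
    and m: "code_certificate k (\<lambda>i. \<phi> (gen i)) m"
    and w: "extremal_words k ((2 * k) ^ window_len m) (\<lambda>i. \<phi> (gen i)) wa wb"
    and a: "a = of_nat (cyc_len (subst (\<lambda>i. \<phi> (gen i)) wa)) / of_nat (cyc_len wa)"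
    and b: "b = of_nat (cyc_len (subst (\<lambda>i. \<phi> (gen i)) wb)) / of_nat (cyc_len wb)"
  shows "0 < a \<and> a \<le> b \<and> distortion_spectrum k \<phi> = {real_of_rat a .. real_of_rat b} \<inter> \<rat>"
proof -
  let ?g = "\<lambda>i. \<phi> (gen i)"
  interpret bilipschitz k m "subst ?g"
    using bilipschitz_subst[OF \<phi> _ code_certificate_bound[OF m]] assms(1) by simp
  have ab: "a = ratio wa" "b = ratio wb" by (simp_all add: a b ratio_def)
  have over: "word_over k wa" "cyc_len wa \<noteq> 0" "word_over k wb" "cyc_len wb \<noteq> 0"
    using w by (simp_all add: extremal_words_def)
  have spec: "ratio ` {w. word_over k w \<and> cyc_len w \<noteq> 0} = {a .. b}"
    unfolding ab
  proof (rule ratio_spectrum[OF assms(1) over])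
    fix u assume u: "word_over k u" "length u \<le> (2 * k) ^ window_len m" "cyc_len u \<noteq> 0"
    then have "word_code u \<le> code_bound k ((2 * k) ^ window_len m)"
      by (intro word_code_le_code_bound)
    then show "cyc_len (subst ?g wa) * cyc_len u \<le> cyc_len (subst ?g u) * cyc_len wa \<and>
        cyc_len (subst ?g u) * cyc_len wb \<le> cyc_len (subst ?g wb) * cyc_len u"
      using w u(1,3) unfolding extremal_words_def by (metis word_code_inverse)
  qed
  have "0 < a" using ratio_pos[OF over(1,2)] ab by simp
  moreover have "a \<le> b"
  proof -
    have "a \<in> {a .. b}" unfolding spec[symmetric] using over ab by auto
    then show ?thesis by simp
  qed
  moreover have "distortion_spectrum k \<phi> = real_of_rat ` ratio ` {w. word_over k w \<and> cyc_len w \<noteq> 0}"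
    unfolding distortion_spectrum_eq[OF \<phi>] image_image
    by (auto simp: ratio_def of_rat_divide)
  moreover have "real_of_rat ` {a .. b} = {real_of_rat a .. real_of_rat b} \<inter> \<rat>"
    by (auto simp: of_rat_less_eq elim!: Rats_cases)
  ultimately show ?thesis unfolding spec by simp
qed

text \<open>The program searches for the code of a triple \<open>(m, wa, wb)\<close>.\<close>

definition triple_1 :: "nat \<Rightarrow> nat" where
  "triple_1 z = fst (prod_decode z)"

definition triple_2 :: "nat \<Rightarrow> word" where
  "triple_2 z = word_decode (fst (prod_decode (snd (prod_decode z))))"

definition triple_3 :: "nat \<Rightarrow> word" where
  "triple_3 z = word_decode (snd (prod_decode (snd (prod_decode z))))"

lemma ex_triple: "\<exists>z. triple_1 z = m \<and> triple_2 z = u \<and> triple_3 z = v"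
  by (rule exI[of _ "prod_encode (m, prod_encode (word_code u, word_code v))"])
    (simp add: triple_1_def triple_2_def triple_3_def)

lemma computable_triple [computable_intros]:
  assumes "computable n f"
  shows "computable n (\<lambda>xs. triple_1 (f xs))"
    and "computable_word n (\<lambda>xs. triple_2 (f xs))"
    and "computable_word n (\<lambda>xs. triple_3 (f xs))"
  unfolding triple_1_def triple_2_def triple_3_def by (intro computable_intros assms)+

definition solution :: "nat \<Rightarrow> nat \<Rightarrow> nat \<Rightarrow> bool" where
  "solution k z c \<longleftrightarrow> code_certificate k (decode_image c) (triple_1 z) \<and>
     extremal_words k ((2 * k) ^ window_len (triple_1 z)) (decode_image c) (triple_2 z) (triple_3 z)"

definition endpoint_codes :: "nat \<Rightarrow> nat \<Rightarrow> nat" where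
  "endpoint_codes z c = prod_encode
     (prod_encode (cyc_len (subst (decode_image c) (triple_2 z)), cyc_len (triple_2 z)),
      prod_encode (cyc_len (subst (decode_image c) (triple_3 z)), cyc_len (triple_3 z)))"

lemma computable_gen [computable_intros]:
  assumes "computable n f" shows "computable_word n (\<lambda>xs. gen (f xs))"
proof -
  have "computable n (\<lambda>xs. Suc (prod_encode (2 * f xs, 0)))" by (intro computable_intros assms)
  then show ?thesis
    by (simp add: computable_word_def gen_def word_code_Cons word_code_Nil letter_code_def)
qed

lemma decidable_solution: "decidable (Suc (Suc 0)) (\<lambda>xs. solution k (hd xs) (hd (tl xs)))"
  unfolding solution_def code_certificate_def extremal_words_def window_len_def cancel_const_def
  by (intro computable_intros) simp_all

lemma computable_endpoint_codes:
  "computable (Suc (Suc 0)) (\<lambda>xs. endpoint_codes (hd xs) (hd (tl xs)))"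
  unfolding endpoint_codes_def by (intro computable_intros) simp_all

theorem theorem1:
  fixes k :: nat
  assumes "k \<ge> 2"
  shows "\<exists>P. \<forall>\<phi> \<in> auto (free_grp k). \<exists>a b :: rat.
           0 < a \<and> a \<le> b \<and>
           distortion_spectrum k \<phi> = {real_of_rat a .. real_of_rat b} \<inter> \<rat> \<and>
           outputs_rat_pair P (map (\<lambda>i. word_code (\<phi> (gen i))) [0..<k]) a b"
proof -
  \<comment> \<open>The program depends only on \<open>k\<close>: it packs its \<open>k\<close>
    arguments into one code before testing a candidate.\<close>
  have vars: "computable (Suc k) (\<lambda>ys. hd ys)" "computable (Suc k) (\<lambda>ys. list_encode (tl ys))"
    by (intro computable_intros computable_tl computable_list_encode; simp)+
  have "decidable (Suc k) (\<lambda>ys. solution k (hd ys) (list_encode (tl ys)))"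
    unfolding decidable_def
    by (rule computable_comp2[OF decidable_solution[unfolded decidable_def] vars])
  moreover have "computable (Suc k) (\<lambda>ys. endpoint_codes (hd ys) (list_encode (tl ys)))"
    by (rule computable_comp2[OF computable_endpoint_codes vars])
  ultimately obtain P where P: "\<And>xs. length xs = k \<Longrightarrow> \<exists>z. solution k z (list_encode xs) \<Longrightarrow>
      \<exists>z. solution k z (list_encode xs) \<and> evaluates P xs (endpoint_codes z (list_encode xs))"
    using computable_search[of k "\<lambda>z xs. solution k z (list_encode xs)"
        "\<lambda>z xs. endpoint_codes z (list_encode xs)"] by blast
  show ?thesis
  proof (intro exI[of _ P] ballI)
    fix \<phi> assume \<phi>: "\<phi> \<in> auto (free_grp k)"
    let ?g = "\<lambda>i. \<phi> (gen i)"
    define xs where "xs = map (\<lambda>i. word_code (\<phi> (gen i))) [0..<k]"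
    have img: "decode_image (list_encode xs) i = ?g i" if "i < k" for i
      unfolding xs_def by (rule decode_image_list_encode[OF that])
    have sol_iff: "solution k z (list_encode xs) \<longleftrightarrow> code_certificate k ?g (triple_1 z) \<and>
        extremal_words k ((2 * k) ^ window_len (triple_1 z)) ?g (triple_2 z) (triple_3 z)" for z
      unfolding solution_def
      using code_certificate_cong[of k "decode_image (list_encode xs)" ?g]
        extremal_words_cong[of k "decode_image (list_encode xs)" ?g] img by simp
    obtain m where m: "code_certificate k ?g m" using ex_code_certificate[OF \<phi>] by blast
    have "bilipschitz k m (subst ?g)"
      using bilipschitz_subst[OF \<phi> _ code_certificate_bound[OF m]] assms by simp
    then obtain wa wb where "extremal_words k ((2 * k) ^ window_len m) ?g wa wb"
      using ex_extremal_words assms by fastforce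
    then have "\<exists>z. solution k z (list_encode xs)"
      unfolding sol_iff using ex_triple[of m wa wb] m by blast
    then obtain z where z: "solution k z (list_encode xs)"
      "evaluates P xs (endpoint_codes z (list_encode xs))"
      using P[of xs] by (auto simp: xs_def)
    define a b where
      "a = (of_nat (cyc_len (subst ?g (triple_2 z))) / of_nat (cyc_len (triple_2 z)) :: rat)" and
      "b = (of_nat (cyc_len (subst ?g (triple_3 z))) / of_nat (cyc_len (triple_3 z)) :: rat)"
    have sol: "code_certificate k ?g (triple_1 z)"
      "extremal_words k ((2 * k) ^ window_len (triple_1 z)) ?g (triple_2 z) (triple_3 z)"
      using z(1) unfolding sol_iff by blast+
    then have "word_over k (triple_2 z)" "word_over k (triple_3 z)"
      by (simp_all add: extremal_words_def)
    then have "evaluates P xs (prod_encode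
        (prod_encode (cyc_len (subst ?g (triple_2 z)), cyc_len (triple_2 z)),
         prod_encode (cyc_len (subst ?g (triple_3 z)), cyc_len (triple_3 z))))"
      using z(2) subst_cong[of k "decode_image (list_encode xs)" ?g] img
      by (simp add: endpoint_codes_def)
    then have "outputs_rat_pair P xs a b"
      unfolding outputs_rat_pair_def
      by (intro exI conjI, assumption) (simp_all add: frac_of_code_def a_def b_def)
    then show "\<exists>a b. 0 < a \<and> a \<le> b \<and>
        distortion_spectrum k \<phi> = {real_of_rat a .. real_of_rat b} \<inter> \<rat> \<and>
        outputs_rat_pair P (map (\<lambda>i. word_code (\<phi> (gen i))) [0..<k]) a b"
      using distortion_spectrum_interval[OF assms \<phi> sol a_def b_def] unfolding xs_def by blast
  qed
qed

end
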